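(* Let $\Lambda\subset\mathrm{Spec}(\mathcal{A})$ be a finite set of eigenvalues, let $E=E(\Lambda)$ be the associated invariant subspace, let $r=\dim E$, and let $S=S(\Lambda)$ be the $L^2(\Omega)$-orthogonal projector onto $E$. Let $\hat E\subset\mathcal{H}$ be a real subspace of dimension $r$ with basis $\{\hat\phi_1,\ldots,\hat\phi_r\}$, and let $0<\hat\mu_1\le\cdots\le\hat\mu_r$ be real numbers with $\hat\mu_i\notin\mathrm{Spec}(\mathcal{A})\setminus\Lambda$ for $1\le i\le r$; write $\hat\Lambda=\{\hat\mu_1,\ldots,\hat\mu_r\}$. Let $G\in\mathbb{R}^{r\times r}$ be the Gram matrix $G_{ij}=B(\hat\phi_j,\hat\phi_i)$, let $\lambda_{\min}(G)$ be its smallest eigenvalue, and let $C(\hat\Lambda,\Lambda)=\max\{C(\hat\mu_j,\Lambda):1\le j\le r\}$. Then $$\sup_{\hat v\in\hat E\setminus\{0\}}\frac{|\!|\!|(I-S)\hat v|\!|\!|^2}{|\!|\!|\hat v|\!|\!|^2}\le\frac{[C(\hat\Lambda,\Lambda)]^2}{\lambda_{\min}(G)}\sum_{j=1}^r|\!|\!|\hat\phi_j-\mathcal{A}^{-1}(\hat\mu_j\hat\phi_j)|\!|\!|^2 .$$ If we further assume that $B(\hat\phi_i,\hat\phi_j)=\hat\mu_i\delta_{ij}$ for all $1\le i,j\le r$, then $$\sup_{\hat v\in\hat E\setminus\{0\}}\frac{|\!|\!|(I-S)\hat v|\!|\!|^2}{|\!|\!|\hat v|\!|\!|^2}\le[C(\hat\Lambda,\Lambda)]^2\sum_{j=1}^r\frac{|\!|\!|\hat\phi_j-\mathcal{A}^{-1}(\hat\mu_j\hat\phi_j)|\!|\!|^2}{\hat\mu_j}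 ,$$ as well as $$\sum_{j=1}^r(\hat\mu_j-\mu_j)\le[C(\hat\Lambda,\Lambda)]^2\sum_{j=1}^r|\!|\!|\hat\phi_j-\mathcal{A}^{-1}(\hat\mu_j\hat\phi_j)|\!|\!|^2 ,$$ where $\Lambda=\{\mu_1,\ldots,\mu_r\}$ with $\mu_1\le\cdots\le\mu_r$ (eigenvalues repeated according to multiplicity).
   Context: All spaces are real. $\Omega\subset\mathbb{R}^d$ is open and bounded, $(\cdot,\cdot)$ and $\|\cdot\|_0$ are the $L^2(\Omega)$ inner product and norm, and $\mathcal{H}\subset H^1(\Omega)$ is the subspace incorporating homogeneous Dirichlet, Neumann, or mixed Dirichlet/Neumann boundary conditions. The bilinear form is $$B(v,w)=\int_\Omega A\nabla v\cdot\nabla w+b\,v\,w\,dx,\qquad v,w\in\mathcal{H},$$ with $A\in[L^\infty(\Omega)]^{d\times d}$ and $b\in L^\infty(\Omega)$ such that $B$ is an inner product on $\mathcal{H}$ whose induced energy norm $|\!|\!|v|\!|\!|=\sqrt{B(v,v)}$ is equivalent to the $H^1(\Omega)$ norm. $\mathcal{A}$ is the self-adjoint, positive definite (unbounded) operator on $L^2(\Omega)$ associated with $B$, i.e. $\mathrm{Dom}(\mathcal{A})\subset\mathcal{H}$ and $(\mathcal{A}v,w)=B(v,w)$ for all $v\in\mathrm{Dom}(\mathcal{A})$, $w\in\mathcal{H}$. For $f\in L^2(\Omega)$, $\mathcal{A}^{-1}f$ is the unique $u\in\mathcal{H}$ with $B(u,v)=(f,v)$ for all $v\in\mathcal{H}$.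 Standing spectral setting: $\mathrm{Spec}(\mathcal{A})$ consists of eigenvalues $0<\lambda_1<\lambda_2\le\lambda_3\le\cdots$ (counted with multiplicity) with no finite accumulation point, and there are corresponding eigenvectors $\psi_n$ (so $B(\psi_n,v)=\lambda_n(\psi_n,v)$ for all $v\in\mathcal{H}$) forming an orthonormal Hilbert basis of $L^2(\Omega)$. For a finite set $\Lambda\subset\mathrm{Spec}(\mathcal{A})$, $$E(\Lambda)=\mathrm{span}\{\psi\in\mathrm{Dom}(\mathcal{A}):\mathcal{A}\psi=\lambda\psi\text{ for some }\lambda\in\Lambda\}.$$ For a non-zero real number $\hat\mu\notin\mathrm{Spec}(\mathcal{A})\setminus\Lambda$, $$C(\hat\mu,\Lambda)=\max_{\xi\in(\mathrm{Spec}(\mathcal{A})\setminus\Lambda)\cup\{0\}}\frac{\xi}{|\xi-\hat\mu|}.$$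
   Formalization: The last inequality (for the sum of μ̂_j − μ_j) is proved under the added assumption that the φ̂_j are orthonormal in L²(Ω); without it the inequality fails, e.g. Ω=(0,π), Dirichlet Laplacian, Λ={1}, μ̂_1=1.1, φ̂_1=√1.1 ψ_1. *)

theory Defs
  imports "HOL-Analysis.Analysis" "Jordan_Normal_Form.Char_Poly"
begin

section \<open>Square integrable functions modulo equality almost everywhere\<close>

definition sq_integrable :: "('a::euclidean_space \<Rightarrow> real) \<Rightarrow> bool" where
  "sq_integrable f \<longleftrightarrow> f \<in> borel_measurable lebesgue \<and> integrable lebesgue (\<lambda>x. (f x)\<^sup>2)"

lemma sq_integrable_zero: "sq_integrable (\<lambda>x. 0)"
  by (simp add: sq_integrable_def)

lemma sq_integrable_mult:
  assumes "sq_integrable f" "sq_integrable g"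
  shows "integrable lebesgue (\<lambda>x. f x * g x)"
proof (rule Bochner_Integration.integrable_bound)
  show "integrable lebesgue (\<lambda>x. (f x)\<^sup>2 + (g x)\<^sup>2)"
    using assms by (auto simp: sq_integrable_def)
  show "(\<lambda>x. f x * g x) \<in> borel_measurable lebesgue"
    using assms by (auto simp: sq_integrable_def)
  have "\<bar>a * b\<bar> \<le> a\<^sup>2 + b\<^sup>2" for a b :: real
  proof -
    have "2 * (\<bar>a\<bar> * \<bar>b\<bar>) \<le> a\<^sup>2 + b\<^sup>2"
      using sum_squares_bound[of "\<bar>a\<bar>" "\<bar>b\<bar>"] by simp
    moreover have "0 \<le> \<bar>a\<bar> * \<bar>b\<bar>" by simp
    ultimately show ?thesis unfolding abs_mult by linarith
  qed
  then show "AE x in lebesgue. norm (f x * g x) \<le> norm ((f x)\<^sup>2 + (g x)\<^sup>2)"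
    by simp
qed

lemma sq_integrable_add:
  assumes "sq_integrable f" "sq_integrable g"
  shows "sq_integrable (\<lambda>x. f x + g x)"
proof -
  have "integrable lebesgue (\<lambda>x. (f x)\<^sup>2 + (g x)\<^sup>2 + 2 * (f x * g x))"
    using assms sq_integrable_mult[OF assms] by (auto simp: sq_integrable_def)
  then have "integrable lebesgue (\<lambda>x. (f x + g x)\<^sup>2)"
    by (simp add: power2_sum mult.assoc)
  then show ?thesis
    using assms by (auto simp: sq_integrable_def)
qed

lemma sq_integrable_scale: "sq_integrable f \<Longrightarrow> sq_integrable (\<lambda>x. c * f x)"
  by (auto simp: sq_integrable_def power_mult_distrib)

lemma sq_integrable_uminus: "sq_integrable f \<Longrightarrow> sq_integrable (\<lambda>x. - f x)"
  using sq_integrable_scale[of f "-1"] by simp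

lemma sq_integrable_diff:
  "sq_integrable f \<Longrightarrow> sq_integrable g \<Longrightarrow> sq_integrable (\<lambda>x. f x - g x)"
  using sq_integrable_add[of f "\<lambda>x. - g x"] sq_integrable_uminus[of g] by simp

definition sq_eq :: "('a::euclidean_space \<Rightarrow> real) \<Rightarrow> ('a \<Rightarrow> real) \<Rightarrow> bool" where
  "sq_eq f g \<longleftrightarrow> sq_integrable f \<and> sq_integrable g \<and> (AE x in lebesgue. f x = g x)"

quotient_type (overloaded) 'a L2 = "'a::euclidean_space \<Rightarrow> real" / partial: sq_eq
proof (rule part_equivpI)
  show "\<exists>f :: 'a \<Rightarrow> real. sq_eq f f"
    by (rule exI[of _ "\<lambda>x. 0"]) (simp add: sq_eq_def sq_integrable_zero)
  show "symp (sq_eq :: ('a \<Rightarrow> real) \<Rightarrow> _)"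
    by (rule sympI) (auto simp: sq_eq_def elim: eventually_mono)
  show "transp (sq_eq :: ('a \<Rightarrow> real) \<Rightarrow> _)"
  proof (rule transpI)
    fix f g h :: "'a \<Rightarrow> real"
    assume "sq_eq f g" "sq_eq g h"
    then show "sq_eq f h"
      unfolding sq_eq_def by (auto elim: eventually_elim2)
  qed
qed

lemma sq_eq_I:
  "sq_integrable f \<Longrightarrow> sq_integrable g \<Longrightarrow> AE x in lebesgue. f x = g x \<Longrightarrow> sq_eq f g"
  by (simp add: sq_eq_def)

lemma sq_eq_rep: "sq_eq (rep_L2 f) (rep_L2 f)"
  by (metis Quotient3_L2 Quotient3_rep_reflp)

lemma sq_integrable_rep [simp]: "sq_integrable (rep_L2 f)"
  using sq_eq_rep[of f] by (simp add: sq_eq_def)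

lemma abs_rep_L2: "abs_L2 (rep_L2 f) = f"
  by (metis Quotient3_L2 Quotient3_abs_rep)

lemma rep_abs_L2:
  assumes "sq_integrable f"
  shows "AE x in lebesgue. rep_L2 (abs_L2 f) x = f x"
proof -
  have "sq_eq f f" using assms by (simp add: sq_eq_def)
  then have "sq_eq (rep_L2 (abs_L2 f)) f"
    by (metis Quotient3_L2 rep_abs_rsp_left)
  then show ?thesis by (simp add: sq_eq_def)
qed

lemma L2_eqI:
  assumes "AE x in lebesgue. rep_L2 f x = rep_L2 g x"
  shows "f = g"
proof -
  have "sq_eq (rep_L2 f) (rep_L2 g)"
    using assms by (simp add: sq_eq_def)
  then show ?thesis
    by (metis Quotient3_L2 Quotient3_rel_rep)
qed

instantiation L2 :: (euclidean_space) real_vector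
begin

definition zero_L2 :: "'a L2" where "0 = abs_L2 (\<lambda>x. 0)"
definition plus_L2 :: "'a L2 \<Rightarrow> 'a L2 \<Rightarrow> 'a L2" where
  "f + g = abs_L2 (\<lambda>x. rep_L2 f x + rep_L2 g x)"
definition minus_L2 :: "'a L2 \<Rightarrow> 'a L2 \<Rightarrow> 'a L2" where
  "f - g = abs_L2 (\<lambda>x. rep_L2 f x - rep_L2 g x)"
definition uminus_L2 :: "'a L2 \<Rightarrow> 'a L2" where
  "- f = abs_L2 (\<lambda>x. - rep_L2 f x)"
definition scaleR_L2 :: "real \<Rightarrow> 'a L2 \<Rightarrow> 'a L2" where
  "c *\<^sub>R f = abs_L2 (\<lambda>x. c * rep_L2 f x)"

lemma rep_zero: "AE x in lebesgue. rep_L2 (0::'a L2) x = 0"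
  unfolding zero_L2_def by (rule rep_abs_L2[OF sq_integrable_zero])

lemma rep_plus: "AE x in lebesgue. rep_L2 (f + g :: 'a L2) x = rep_L2 f x + rep_L2 g x"
  unfolding plus_L2_def by (rule rep_abs_L2) (simp add: sq_integrable_add)

lemma rep_minus: "AE x in lebesgue. rep_L2 (f - g :: 'a L2) x = rep_L2 f x - rep_L2 g x"
  unfolding minus_L2_def by (rule rep_abs_L2) (simp add: sq_integrable_diff)

lemma rep_uminus: "AE x in lebesgue. rep_L2 (- f :: 'a L2) x = - rep_L2 f x"
  unfolding uminus_L2_def by (rule rep_abs_L2) (simp add: sq_integrable_uminus)

lemma rep_scaleR: "AE x in lebesgue. rep_L2 (c *\<^sub>R f :: 'a L2) x = c * rep_L2 f x"
  unfolding scaleR_L2_def by (rule rep_abs_L2) (simp add: sq_integrable_scale)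

instance
proof
  fix a b c :: "'a L2" and s t :: real
  show "a + b + c = a + (b + c)"
    by (rule L2_eqI)
      (use rep_plus[of "a + b" c] rep_plus[of a b] rep_plus[of a "b + c"] rep_plus[of b c]
       in eventually_elim, simp)
  show "a + b = b + a"
    by (rule L2_eqI) (use rep_plus[of a b] rep_plus[of b a] in eventually_elim, simp)
  show "0 + a = a"
    by (rule L2_eqI) (use rep_plus[of 0 a] rep_zero in eventually_elim, simp)
  show "- a + a = 0"
    by (rule L2_eqI)
      (use rep_plus[of "- a" a] rep_uminus[of a] rep_zero in eventually_elim, simp)
  show "a - b = a + - b"
    by (rule L2_eqI)
      (use rep_plus[of a "- b"] rep_uminus[of b] rep_minus[of a b] in eventually_elim, simp)
  show "s *\<^sub>R (a + b) = s *\<^sub>R a + s *\<^sub>R b"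
    by (rule L2_eqI)
      (use rep_scaleR[of s "a + b"] rep_plus[of a b] rep_plus[of "s *\<^sub>R a" "s *\<^sub>R b"]
           rep_scaleR[of s a] rep_scaleR[of s b]
       in eventually_elim, simp add: distrib_left)
  show "(s + t) *\<^sub>R a = s *\<^sub>R a + t *\<^sub>R a"
    by (rule L2_eqI)
      (use rep_scaleR[of "s + t" a] rep_plus[of "s *\<^sub>R a" "t *\<^sub>R a"]
           rep_scaleR[of s a] rep_scaleR[of t a]
       in eventually_elim, simp add: distrib_right)
  show "s *\<^sub>R t *\<^sub>R a = (s * t) *\<^sub>R a"
    by (rule L2_eqI)
      (use rep_scaleR[of s "t *\<^sub>R a"] rep_scaleR[of t a] rep_scaleR[of "s * t" a]
       in eventually_elim, simp)
  show "1 *\<^sub>R a = a"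
    by (rule L2_eqI) (use rep_scaleR[of 1 a] in eventually_elim, simp)
qed

end

instantiation L2 :: (euclidean_space) real_inner
begin

definition inner_L2 :: "'a L2 \<Rightarrow> 'a L2 \<Rightarrow> real" where
  "inner f g = integral\<^sup>L lebesgue (\<lambda>x. rep_L2 f x * rep_L2 g x)"
definition norm_L2 :: "'a L2 \<Rightarrow> real" where "norm_L2 f = sqrt (inner f f)"
definition dist_L2 :: "'a L2 \<Rightarrow> 'a L2 \<Rightarrow> real" where
  "dist_L2 f g = sqrt (inner (f - g) (f - g))"
definition sgn_L2 :: "'a L2 \<Rightarrow> 'a L2" where "sgn_L2 f = f /\<^sub>R sqrt (inner f f)"
definition uniformity_L2 :: "('a L2 \<times> 'a L2) filter" where
  "uniformity_L2 = (INF e\<in>{0<..}. principal {(f, g). sqrt (inner (f - g) (f - g)) < e})"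
definition open_L2 :: "'a L2 set \<Rightarrow> bool" where
  "open_L2 U = (\<forall>f\<in>U. eventually (\<lambda>(f', g). f' = f \<longrightarrow> g \<in> U)
     (INF e\<in>{0<..}. principal {(f, g). sqrt (inner (f - g) (f - g)) < e}))"

instance
proof
  have meas [measurable]: "rep_L2 (f::'a L2) \<in> borel_measurable lebesgue" for f
    using sq_integrable_rep[of f] by (simp add: sq_integrable_def)
  fix f g h :: "'a L2" and c :: real
  show "inner f g = inner g f" by (simp add: inner_L2_def mult.commute)
  show "inner (f + g) h = inner f h + inner g h"
  proof -
    have "inner (f + g) h
        = integral\<^sup>L lebesgue (\<lambda>x. rep_L2 f x * rep_L2 h x + rep_L2 g x * rep_L2 h x)"
      unfolding inner_L2_def
      by (rule integral_cong_AE; measurable?)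
         (use rep_plus[of f g] in eventually_elim, simp add: distrib_right)
    also have "\<dots> = inner f h + inner g h"
      unfolding inner_L2_def
      by (rule Bochner_Integration.integral_add) (simp_all add: sq_integrable_mult)
    finally show ?thesis .
  qed
  show "inner (c *\<^sub>R f) g = c * inner f g"
  proof -
    have "inner (c *\<^sub>R f) g = integral\<^sup>L lebesgue (\<lambda>x. c * (rep_L2 f x * rep_L2 g x))"
      unfolding inner_L2_def
      by (rule integral_cong_AE; measurable?)
         (use rep_scaleR[of c f] in eventually_elim, simp)
    then show ?thesis by (simp add: inner_L2_def)
  qed
  show "0 \<le> inner f f" by (simp add: inner_L2_def)
  show "(inner f f = 0) = (f = 0)"
  proof -
    have "inner f f = 0 \<longleftrightarrow> (AE x in lebesgue. rep_L2 f x * rep_L2 f x = 0)"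
      unfolding inner_L2_def
      by (rule integral_nonneg_eq_0_iff_AE) (simp_all add: sq_integrable_mult)
    also have "\<dots> \<longleftrightarrow> f = 0"
    proof
      assume h: "AE x in lebesgue. rep_L2 f x * rep_L2 f x = 0"
      show "f = 0"
        by (rule L2_eqI) (use h rep_zero in eventually_elim, simp)
    next
      assume "f = 0"
      then show "AE x in lebesgue. rep_L2 f x * rep_L2 f x = 0"
        using rep_zero by (auto elim: eventually_mono)
    qed
    finally show ?thesis .
  qed
qed (simp_all only: norm_L2_def dist_L2_def sgn_L2_def uniformity_L2_def open_L2_def)

end

text \<open>
  \<open>L\<^sup>2(\<Omega>)\<close> is the isometric image under extension by zero: the classes in
  \<open>L\<^sup>2(\<real>\<^sup>d)\<close> vanishing outside \<open>\<Omega>\<close>. Inner product and norm are inherited, and span,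
  dimension and closure below are those of the real inner product space \<open>'a L2\<close>.
\<close>

definition L2_on :: "'a::euclidean_space set \<Rightarrow> 'a L2 set" where
  "L2_on \<Omega> = {f. AE x in lebesgue. x \<notin> \<Omega> \<longrightarrow> rep_L2 f x = 0}"

definition Linf_on :: "'a::euclidean_space set \<Rightarrow> ('a \<Rightarrow> real) \<Rightarrow> bool" where
  "Linf_on \<Omega> f \<longleftrightarrow> f \<in> borel_measurable (lebesgue_on \<Omega>) \<and>
     (\<exists>K. AE x in lebesgue_on \<Omega>. \<bar>f x\<bar> \<le> K)"


section \<open>Weak derivatives and Sobolev spaces\<close>

definition partial_deriv :: "'d::finite \<Rightarrow> (real^'d \<Rightarrow> real) \<Rightarrow> real^'d \<Rightarrow> real" where
  "partial_deriv i f x = frechet_derivative f (at x) (axis i 1)"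

primrec Ck :: "nat \<Rightarrow> (real^'d::finite \<Rightarrow> real) \<Rightarrow> bool" where
  "Ck 0 f \<longleftrightarrow> continuous_on UNIV f"
| "Ck (Suc k) f \<longleftrightarrow> (\<forall>x. f differentiable (at x)) \<and> (\<forall>i. Ck k (partial_deriv i f))"

definition test_fun :: "(real^'d::finite) set \<Rightarrow> (real^'d \<Rightarrow> real) \<Rightarrow> bool" where
  "test_fun \<Omega> \<phi> \<longleftrightarrow> (\<forall>k. Ck k \<phi>) \<and> (\<exists>K. compact K \<and> K \<subseteq> \<Omega> \<and> (\<forall>x. x \<notin> K \<longrightarrow> \<phi> x = 0))"

definition is_weak_partial ::
    "(real^'d::finite) set \<Rightarrow> 'd \<Rightarrow> (real^'d) L2 \<Rightarrow> (real^'d) L2 \<Rightarrow> bool" where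
  "is_weak_partial \<Omega> i v g \<longleftrightarrow> g \<in> L2_on \<Omega> \<and>
     (\<forall>\<phi>. test_fun \<Omega> \<phi> \<longrightarrow>
        integral\<^sup>L (lebesgue_on \<Omega>) (\<lambda>x. rep_L2 v x * partial_deriv i \<phi> x)
        = - integral\<^sup>L (lebesgue_on \<Omega>) (\<lambda>x. rep_L2 g x * \<phi> x))"

definition H1 :: "(real^'d::finite) set \<Rightarrow> (real^'d) L2 set" where
  "H1 \<Omega> = {v \<in> L2_on \<Omega>. \<forall>i. \<exists>g. is_weak_partial \<Omega> i v g}"

definition weak_partial :: "(real^'d::finite) set \<Rightarrow> 'd \<Rightarrow> (real^'d) L2 \<Rightarrow> (real^'d) L2" where
  "weak_partial \<Omega> i v = (THE g. is_weak_partial \<Omega> i v g)"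

definition weak_grad :: "(real^'d::finite) set \<Rightarrow> (real^'d) L2 \<Rightarrow> real^'d \<Rightarrow> real^'d" where
  "weak_grad \<Omega> v x = (\<chi> i. rep_L2 (weak_partial \<Omega> i v) x)"

definition norm_H1 :: "(real^'d::finite) set \<Rightarrow> (real^'d) L2 \<Rightarrow> real" where
  "norm_H1 \<Omega> v = sqrt ((norm v)\<^sup>2 + (\<Sum>i\<in>UNIV. (norm (weak_partial \<Omega> i v))\<^sup>2))"

text \<open>
  Functions in \<open>H\<^sup>1(\<Omega>)\<close> with homogeneous Dirichlet condition on \<open>\<Gamma> \<subseteq> \<partial>\<Omega>\<close> and (natural)
  Neumann condition on the rest: the \<open>H\<^sup>1\<close>-closure of the functions vanishing near \<open>\<Gamma>\<close>.
  No boundary regularity, hence no trace operator, is needed. For bounded \<open>\<Omega>\<close>,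
  \<open>\<Gamma> = frontier \<Omega>\<close> gives the closure of the test functions (Dirichlet), \<open>\<Gamma> = {}\<close> all of
  \<open>H\<^sup>1(\<Omega>)\<close> (Neumann).
\<close>

definition vanishes_near :: "(real^'d::finite) set \<Rightarrow> (real^'d) set \<Rightarrow> (real^'d) L2 \<Rightarrow> bool" where
  "vanishes_near \<Omega> \<Gamma> v \<longleftrightarrow>
     (\<exists>U. open U \<and> \<Gamma> \<subseteq> U \<and> (AE x in lebesgue. x \<in> U \<inter> \<Omega> \<longrightarrow> rep_L2 v x = 0))"

definition H1_bc :: "(real^'d::finite) set \<Rightarrow> (real^'d) set \<Rightarrow> (real^'d) L2 set" where
  "H1_bc \<Omega> \<Gamma> =
     {v \<in> H1 \<Omega>. \<forall>\<epsilon>>0. \<exists>w\<in>H1 \<Omega>. vanishes_near \<Omega> \<Gamma> w \<and> norm_H1 \<Omega> (v - w) < \<epsilon>}"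


section \<open>The bilinear form\<close>

definition bform ::
    "(real^'d::finite) set \<Rightarrow> (real^'d \<Rightarrow> real^'d^'d) \<Rightarrow> (real^'d \<Rightarrow> real) \<Rightarrow>
     (real^'d) L2 \<Rightarrow> (real^'d) L2 \<Rightarrow> real" where
  "bform \<Omega> A b v w = integral\<^sup>L (lebesgue_on \<Omega>)
     (\<lambda>x. inner (A x *v weak_grad \<Omega> v x) (weak_grad \<Omega> w x) + b x * rep_L2 v x * rep_L2 w x)"

definition inner_product_on :: "'v::real_vector set \<Rightarrow> ('v \<Rightarrow> 'v \<Rightarrow> real) \<Rightarrow> bool" where
  "inner_product_on H B \<longleftrightarrow>
     (\<forall>u\<in>H. \<forall>v\<in>H. B u v = B v u) \<and>
     (\<forall>u\<in>H. \<forall>v\<in>H. \<forall>w\<in>H. B (u + v) w = B u w + B v w) \<and>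
     (\<forall>c. \<forall>u\<in>H. \<forall>v\<in>H. B (c *\<^sub>R u) v = c * B u v) \<and>
     (\<forall>u\<in>H. u \<noteq> 0 \<longrightarrow> 0 < B u u)"

definition energy_norm :: "('v \<Rightarrow> 'v \<Rightarrow> real) \<Rightarrow> 'v \<Rightarrow> real" where
  "energy_norm B v = sqrt (B v v)"

definition norms_equivalent_on :: "'v set \<Rightarrow> ('v \<Rightarrow> real) \<Rightarrow> ('v \<Rightarrow> real) \<Rightarrow> bool" where
  "norms_equivalent_on H N M \<longleftrightarrow>
     (\<exists>c>0. \<exists>C>0. \<forall>v\<in>H. c * M v \<le> N v \<and> N v \<le> C * M v)"


section \<open>The operator associated with a form\<close>

text \<open>
  \<open>L\<close> is the ambient Hilbert space (here \<open>L\<^sup>2(\<Omega>)\<close>), \<open>H \<subseteq> L\<close> the form domain and \<open>B\<close> the form.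
\<close>

definition op_dom :: "'v::real_inner set \<Rightarrow> 'v set \<Rightarrow> ('v \<Rightarrow> 'v \<Rightarrow> real) \<Rightarrow> 'v set" where
  "op_dom L H B = {v \<in> H. \<exists>f\<in>L. \<forall>w\<in>H. B v w = inner f w}"

definition op :: "'v::real_inner set \<Rightarrow> 'v set \<Rightarrow> ('v \<Rightarrow> 'v \<Rightarrow> real) \<Rightarrow> 'v \<Rightarrow> 'v" where
  "op L H B v = (THE f. f \<in> L \<and> (\<forall>w\<in>H. B v w = inner f w))"

definition op_inv :: "'v::real_inner set \<Rightarrow> ('v \<Rightarrow> 'v \<Rightarrow> real) \<Rightarrow> 'v \<Rightarrow> 'v" where
  "op_inv H B f = (THE u. u \<in> H \<and> (\<forall>v\<in>H. B u v = inner f v))"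

text \<open>
  Complement of the resolvent set. The operator is self-adjoint, so real \<open>z\<close> suffice.
\<close>

definition op_spec :: "'v::real_inner set \<Rightarrow> 'v set \<Rightarrow> ('v \<Rightarrow> 'v \<Rightarrow> real) \<Rightarrow> real set" where
  "op_spec L H B = {z. \<not> (bij_betw (\<lambda>v. op L H B v - z *\<^sub>R v) (op_dom L H B) L \<and>
     (\<exists>K. \<forall>v\<in>op_dom L H B. norm v \<le> K * norm (op L H B v - z *\<^sub>R v)))}"

definition eigenspace :: "'v::real_inner set \<Rightarrow> 'v set \<Rightarrow> ('v \<Rightarrow> 'v \<Rightarrow> real) \<Rightarrow> real \<Rightarrow> 'v set" where
  "eigenspace L H B l = {\<psi> \<in> op_dom L H B. op L H B \<psi> = l *\<^sub>R \<psi>}"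

definition inv_subspace ::
    "'v::real_inner set \<Rightarrow> 'v set \<Rightarrow> ('v \<Rightarrow> 'v \<Rightarrow> real) \<Rightarrow> real set \<Rightarrow> 'v set" where
  "inv_subspace L H B \<Lambda> = span {\<psi> \<in> op_dom L H B. \<exists>l\<in>\<Lambda>. op L H B \<psi> = l *\<^sub>R \<psi>}"

definition orth_proj :: "'v::real_inner set \<Rightarrow> 'v \<Rightarrow> 'v" where
  "orth_proj E v = (THE p. p \<in> E \<and> (\<forall>w\<in>E. inner (v - p) w = 0))"

text \<open>
  \<open>lam 0, lam 1, \<dots>\<close> are the eigenvalues written \<open>\<lambda>\<^sub>1, \<lambda>\<^sub>2, \<dots>\<close> in the usual numbering. That they are
  counted with multiplicity is expressed by \<open>\<psi> n\<close>, an eigenvector for \<open>lam n\<close>, running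
  through an orthonormal Hilbert basis.
\<close>

definition spectral_setting ::
    "'v::real_inner set \<Rightarrow> 'v set \<Rightarrow> ('v \<Rightarrow> 'v \<Rightarrow> real) \<Rightarrow>
     (nat \<Rightarrow> real) \<Rightarrow> (nat \<Rightarrow> 'v) \<Rightarrow> bool" where
  "spectral_setting L H B lam \<psi> \<longleftrightarrow>
     op_spec L H B = range lam \<and>
     0 < lam 0 \<and> lam 0 < lam 1 \<and> mono lam \<and>
     (\<forall>x. \<exists>\<epsilon>>0. finite {n. dist (lam n) x < \<epsilon>}) \<and>
     (\<forall>n. \<psi> n \<in> eigenspace L H B (lam n)) \<and>
     (\<forall>m n. inner (\<psi> m) (\<psi> n) = (if m = n then 1 else 0)) \<and>
     closure (span (range \<psi>)) = L"

definition lists_eigenvalues ::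
    "'v::real_inner set \<Rightarrow> 'v set \<Rightarrow> ('v \<Rightarrow> 'v \<Rightarrow> real) \<Rightarrow> real set \<Rightarrow>
     nat \<Rightarrow> (nat \<Rightarrow> real) \<Rightarrow> bool" where
  "lists_eigenvalues L H B \<Lambda> r \<mu> \<longleftrightarrow>
     mono_on {1..r} \<mu> \<and> \<mu> ` {1..r} = \<Lambda> \<and>
     (\<forall>l\<in>\<Lambda>. card {j \<in> {1..r}. \<mu> j = l} = dim (eigenspace L H B l))"


section \<open>Constants in the estimates\<close>

text \<open>
  For \<open>z > 0\<close> outside \<open>\<sigma> - \<Lambda>\<close> and \<open>\<sigma>\<close> an unbounded set without finite accumulation point, the
  supremum is a maximum: the quotient tends to 1 from above as \<open>\<xi> \<rightarrow> \<infinity>\<close>.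
\<close>

definition gap_const :: "real set \<Rightarrow> real set \<Rightarrow> real \<Rightarrow> real" where
  "gap_const \<sigma> \<Lambda> z = (SUP \<xi>\<in>(\<sigma> - \<Lambda>) \<union> {0}. \<xi> / \<bar>\<xi> - z\<bar>)"

definition gap_const_max :: "real set \<Rightarrow> real set \<Rightarrow> nat \<Rightarrow> (nat \<Rightarrow> real) \<Rightarrow> real" where
  "gap_const_max \<sigma> \<Lambda> r \<mu>h = Max ((\<lambda>j. gap_const \<sigma> \<Lambda> (\<mu>h j)) ` {1..r})"

text \<open>Matrices of \<open>Jordan_Normal_Form\<close> are indexed from 0, the basis from 1.\<close>

definition gram_mat :: "('v \<Rightarrow> 'v \<Rightarrow> real) \<Rightarrow> nat \<Rightarrow> (nat \<Rightarrow> 'v) \<Rightarrow> real Matrix.mat" where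
  "gram_mat B r \<phi> = Matrix.mat r r (\<lambda>(i, j). B (\<phi> (Suc j)) (\<phi> (Suc i)))"

definition min_eigenvalue :: "real Matrix.mat \<Rightarrow> real" where
  "min_eigenvalue G = Min {k. eigenvalue G k}"

text \<open>
  The supremum is taken in the extended reals, so that it carries no implicit boundedness
  assumption and is \<open>-\<infinity>\<close> for \<open>F = {0}\<close>.
\<close>

definition subspace_error :: "('v::real_inner \<Rightarrow> 'v \<Rightarrow> real) \<Rightarrow> 'v set \<Rightarrow> 'v set \<Rightarrow> ereal" where
  "subspace_error B E F =
     (SUP v\<in>F - {0}. ereal ((energy_norm B (v - orth_proj E v))\<^sup>2 / (energy_norm B v)\<^sup>2))"

definition residual ::
    "'v::real_inner set \<Rightarrow> ('v \<Rightarrow> 'v \<Rightarrow> real) \<Rightarrow> real \<Rightarrow> 'v \<Rightarrow> real" where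
  "residual H B z \<phi> = energy_norm B (\<phi> - op_inv H B (z *\<^sub>R \<phi>))"

end

theory Submission
  imports Defs
begin

text \<open>
  Let \<open>a n = (\<phi>, \<psi> n)\<close> be the coefficients of \<open>\<phi> \<in> H\<close>, and let \<open>\<rho> = \<phi> - A\<^sup>-\<^sup>1(\<mu> \<phi>)\<close> be its
  residual, where \<open>A\<^sup>-\<^sup>1\<close> stands for \<open>op_inv H B\<close>.
  Testing \<open>\<rho>\<close> with \<open>\<psi> n\<close> in the form gives \<open>\<lambda> n (\<rho>, \<psi> n) = (\<lambda> n - \<mu>) a n\<close>. When \<open>\<lambda> n \<notin> \<Lambda>\<close>, the
  definition of \<open>C\<close> turns this into \<open>\<bar>a n\<bar> \<le> C \<bar>(\<rho>, \<psi> n)\<bar>\<close>. Weighting the squares with \<open>\<lambda> n\<close> and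
  summing bounds the energy of \<open>(I - S) \<phi>\<close> by \<open>C\<^sup>2\<close> times the energy of \<open>\<rho>\<close>, as far as both energies
  are given by their sums \<open>\<Sum>n. \<lambda> n (\<cdot>, \<psi> n)\<^sup>2\<close>. Bessel's inequality only says that an energy is at least its
  sum, but the nonnegative defect between the two is the same for \<open>\<phi>\<close> and for \<open>\<rho>\<close>, since \<open>\<phi>\<close> and \<open>\<rho>\<close>
  differ by a solution \<open>A\<^sup>-\<^sup>1 f\<close>, for which Parseval's identity in \<open>L\<^sup>2\<close> applies; and \<open>C \<ge> 1\<close> because the
  eigenvalues are unbounded. This is \<open>energy_complement_le_residual\<close>.

  For \<open>v = \<Sum>j. c j \<phi> j\<close> the triangle inequality and a weighted Cauchy-Schwarz inequality give
  \<open>B((I - S) v, (I - S) v) \<le> (\<Sum>j. w j (c j)\<^sup>2) (\<Sum>j. C\<^sup>2 B(\<rho> j, \<rho> j) / w j)\<close> for all positive weights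
  \<open>w\<close>, and any weights with \<open>\<Sum>j. w j (c j)\<^sup>2 \<le> B(v, v)\<close> yield an estimate of the subspace error
  (\<open>complement_of_combination_le\<close>). The constant weight \<open>\<lambda>\<^sub>m\<^sub>i\<^sub>n(G)\<close> is admissible by the Rayleigh
  principle (\<open>min_eigenvalue_rayleigh\<close>), and \<open>w j = \<mu> j\<close> is admissible when the basis is orthogonal
  with \<open>B(\<phi> j, \<phi> j) = \<mu> j\<close>.

  For the eigenvalue estimate, \<open>B(\<phi> j, \<phi> j)\<close> exceeds the energy of \<open>(I - S) \<phi> j\<close> by
  \<open>\<Sum>n. \<lambda> n (\<phi> j, \<psi> n)\<^sup>2\<close> over \<open>\<lambda> n \<in> \<Lambda>\<close>. If the \<open>\<phi> j\<close> are orthonormal in \<open>L\<^sup>2\<close>, Bessel's inequality for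
  \<open>\<psi> n\<close> bounds the sum of these terms over \<open>j\<close> by \<open>\<Sum>n. \<lambda> n\<close>, which is the sum of the eigenvalues
  in \<open>\<Lambda>\<close> (\<open>eigenvalue_sum_le\<close>).

  All this takes place in the linear space \<open>H\<close>. That \<open>H1_bc\<close> is one is the analytic part of the proof:
  the gradient in the \<open>H\<^sup>1\<close> norm is linear only because weak derivatives are unique, that is, by the
  fundamental lemma of the calculus of variations (\<open>fundamental_lemma\<close>). Its test functions are tensor
  products of one-dimensional bumps that converge to the indicators of boxes.
\<close>

section \<open>Smooth bumps on the line\<close>

text \<open>
  The family \<open>p q\<^sup>-\<^sup>m e\<^sup>-\<^sup>c\<^sup>/\<^sup>q\<close> with \<open>q = (t - a) (b - t)\<close>. The polynomial \<open>p\<close> and the exponent \<open>m\<close> are there to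
  make it closed under differentiation, so that smoothness of all its members follows from one formula for the
  first derivative. The parameter \<open>c\<close> tends to \<open>0\<close> later, which flattens the bump to the indicator of the interval.
\<close>

definition bump :: "real \<Rightarrow> real \<Rightarrow> real \<Rightarrow> nat \<Rightarrow> real poly \<Rightarrow> real \<Rightarrow> real" where
  "bump a b c m p t =
     (if a < t \<and> t < b then poly p t / ((t - a) * (b - t)) ^ m * exp (- c / ((t - a) * (b - t))) else 0)"

definition edge_poly :: "real \<Rightarrow> real \<Rightarrow> real poly" where
  "edge_poly a b = [:- a, 1:] * [:b, - 1:]"

lemma poly_edge_poly: "poly (edge_poly a b) t = (t - a) * (b - t)"
  by (simp add: edge_poly_def algebra_simps)

lemma bump_inside:
  assumes "a < t" "t < b"
  shows "bump a b c m p t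
    = poly p t * inverse (poly (edge_poly a b) t) ^ m * exp (- (c * inverse (poly (edge_poly a b) t)))"
  unfolding bump_def poly_edge_poly divide_inverse power_inverse using assms
  by (simp only: if_True simp_thms mult_minus_left)

lemma bump_outside: "\<not> (a < t \<and> t < b) \<Longrightarrow> bump a b c m p t = 0"
  unfolding bump_def by (rule if_not_P)

text \<open>
  The factor \<open>e\<^sup>-\<^sup>c\<^sup>/\<^sup>q\<close> beats every power of \<open>1/q\<close>: one term of the exponential series is below its sum,
  and the term of order \<open>m + 2\<close> leaves two powers of \<open>q\<close> to spare.
\<close>

lemma inverse_power_times_exp_le:
  fixes c q :: real
  assumes "c > 0" "q > 0"
  shows "exp (- c / q) / q ^ m \<le> fact (m + 2) / c ^ (m + 2) * q\<^sup>2"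
proof -
  have "(c / q) ^ (m + 2) / fact (m + 2) \<le> exp (c / q)"
    using sum_le_suminf[OF summable_exp[of "c / q"], of "{m + 2}"] assms
    by (simp add: exp_def divide_inverse mult.commute)
  then have "inverse (exp (c / q)) \<le> inverse ((c / q) ^ (m + 2) / fact (m + 2))"
    using assms by (intro le_imp_inverse_le) auto
  then have "exp (- c / q) \<le> fact (m + 2) / (c / q) ^ (m + 2)"
    by (simp only: minus_divide_left[symmetric] exp_minus inverse_divide)
  then have "exp (- c / q) / q ^ m \<le> fact (m + 2) / (c / q) ^ (m + 2) / q ^ m"
    using assms by (intro divide_right_mono) auto
  also have "\<dots> = fact (m + 2) / c ^ (m + 2) * q\<^sup>2"
  proof -
    have "(c / q) ^ (m + 2) * q ^ m * q\<^sup>2 = c ^ (m + 2)"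
    proof -
      have "q ^ m * q\<^sup>2 = q ^ (m + 2)" by (simp only: power_add)
      moreover have "q ^ (m + 2) \<noteq> 0" using assms by (intro power_not_zero) blast
      ultimately show ?thesis by (simp only: power_divide mult.assoc nonzero_eq_divide_eq times_divide_eq_left) simp
    qed
    moreover have "fact (m + 2) / (c / q) ^ (m + 2) / q ^ m
        = fact (m + 2) / ((c / q) ^ (m + 2) * q ^ m * q\<^sup>2) * q\<^sup>2"
    proof -
      have "F / X / Y = F / (X * Y * Q) * Q" if "Q \<noteq> 0" for F X Y Q :: real
        using that by simp
      from this[of "q\<^sup>2"] show ?thesis using assms(2) by (metis less_irrefl zero_eq_power2)
    qed
    ultimately show ?thesis by (simp only:)
  qed
  finally show ?thesis .
qed

text \<open>
  Gives the derivative \<open>0\<close> at the two end points, where the two defining cases meet.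
\<close>

lemma bump_quadratic_bound:
  assumes "c > 0"
  shows "\<exists>K. \<forall>t. \<bar>bump a b c m p t\<bar> \<le> K * (t - a)\<^sup>2 \<and> \<bar>bump a b c m p t\<bar> \<le> K * (t - b)\<^sup>2"
proof -
  have "bounded (poly p ` {a..b})"
    by (intro compact_imp_bounded compact_continuous_image continuous_intros) auto
  then obtain M where "M > 0" "\<forall>x\<in>poly p ` {a..b}. norm x \<le> M"
    unfolding bounded_pos by blast
  then have M: "\<And>t. a \<le> t \<Longrightarrow> t \<le> b \<Longrightarrow> \<bar>poly p t\<bar> \<le> M"
    by simp
  define D where "D = fact (m + 2) / c ^ (m + 2)"
  have "D > 0" using assms by (simp add: D_def)
  define K where "K = M * D * (b - a)\<^sup>2"
  have "K \<ge> 0" using \<open>M > 0\<close> \<open>D > 0\<close> by (simp add: K_def)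
  have "\<bar>bump a b c m p t\<bar> \<le> K * (t - a)\<^sup>2 \<and> \<bar>bump a b c m p t\<bar> \<le> K * (t - b)\<^sup>2" for t
  proof (cases "a < t \<and> t < b")
    case True
    let ?q = "(t - a) * (b - t)"
    have q: "?q > 0" using True by simp
    have "\<bar>bump a b c m p t\<bar> = \<bar>poly p t\<bar> * (exp (- c / ?q) / ?q ^ m)"
      using True q by (simp add: bump_def abs_mult)
    also have "\<dots> \<le> M * (D * ?q\<^sup>2)"
      unfolding D_def using True q assms \<open>M > 0\<close> inverse_power_times_exp_le[OF assms q, of m]
      by (intro mult_mono M) auto
    finally have *: "\<bar>bump a b c m p t\<bar> \<le> M * D * (t - a)\<^sup>2 * (b - t)\<^sup>2"
      by (simp add: power_mult_distrib mult.assoc)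
    have MD: "M * D \<ge> 0" using \<open>M > 0\<close> \<open>D > 0\<close> by simp
    have "(b - t)\<^sup>2 \<le> (b - a)\<^sup>2" "(t - a)\<^sup>2 \<le> (b - a)\<^sup>2"
      using True by (auto intro!: power_mono)
    then have "M * D * (t - a)\<^sup>2 * (b - t)\<^sup>2 \<le> M * D * (t - a)\<^sup>2 * (b - a)\<^sup>2"
      "M * D * (t - a)\<^sup>2 * (b - t)\<^sup>2 \<le> M * D * (b - a)\<^sup>2 * (b - t)\<^sup>2"
      using MD by (intro mult_left_mono mult_right_mono; simp)+
    moreover have "K * (t - a)\<^sup>2 = M * D * (t - a)\<^sup>2 * (b - a)\<^sup>2"
        "K * (t - b)\<^sup>2 = M * D * (b - a)\<^sup>2 * (b - t)\<^sup>2"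
      unfolding K_def power2_commute[of t b] by (simp_all only: mult_ac)
    ultimately show ?thesis using * by linarith
  next
    case False
    then have "bump a b c m p t = 0" by (rule bump_outside)
    with \<open>K \<ge> 0\<close> show ?thesis by simp
  qed
  then show ?thesis by blast
qed

lemma has_derivative_zero_if_quadratic_bound:
  fixes f :: "real \<Rightarrow> real"
  assumes "\<And>t. \<bar>f t\<bar> \<le> K * (t - a)\<^sup>2"
  shows "(f has_real_derivative 0) (at a)"
proof -
  have fa: "f a = 0" using assms[of a] by simp
  have "((\<lambda>h. K * \<bar>h\<bar>) \<longlongrightarrow> 0) (at 0)" by (auto intro!: tendsto_eq_intros)
  moreover have le: "norm ((f (a + h) - f a) / h) \<le> K * \<bar>h\<bar>" if "h \<noteq> 0" for h
  proof -
    have "\<bar>f (a + h)\<bar> \<le> K * \<bar>h\<bar> * \<bar>h\<bar>"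
      using assms[of "a + h"] by (simp add: power2_eq_square mult.assoc)
    then show ?thesis using that by (simp add: fa abs_divide pos_divide_le_eq)
  qed
  have "\<forall>\<^sub>F h in at 0. norm ((f (a + h) - f a) / h) \<le> K * \<bar>h\<bar>"
    by (rule eventually_mono[OF eventually_neq_at_within]) (rule le)
  ultimately have "((\<lambda>h. (f (a + h) - f a) / h) \<longlongrightarrow> 0) (at 0)"
    by (rule Lim_null_comparison[rotated])
  then show ?thesis by (simp add: DERIV_def)
qed

text \<open>
  Inside the interval the bump is \<open>p u\<^sup>m e\<^sup>-\<^sup>c\<^sup>u\<close> with \<open>u = 1/q\<close> and \<open>u' = - q' u\<^sup>2\<close>; missing powers of \<open>u\<close> are
  supplied by factors \<open>q u = 1\<close>, which puts the three terms of the derivative over the common power \<open>u\<^sup>m\<^sup>+\<^sup>2\<close>.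
\<close>

lemma bump_has_derivative:
  assumes "c > 0"
  shows "(bump a b c m p has_real_derivative
      bump a b c (m + 2) (pderiv p * edge_poly a b ^ 2 - of_nat m * p * pderiv (edge_poly a b) * edge_poly a b
         + Polynomial.smult c (p * pderiv (edge_poly a b))) t) (at t)"
    (is "(_ has_real_derivative bump a b c (m + 2) ?p t) _")
proof -
  consider "a < t" "t < b" | "t = a \<or> t = b" | "t < a \<or> b < t" by linarith
  then show ?thesis
  proof cases
    case 1
    let ?e = "edge_poly a b"
    define u where "u = (\<lambda>t. inverse (poly ?e t))"
    define q' where "q' = poly (pderiv ?e) t"
    define X where "X = exp (- (c * u t))"
    have q: "poly ?e t > 0" using 1 by (simp add: poly_edge_poly)
    have u: "(u has_real_derivative - (q' * (u t)\<^sup>2)) (at t)"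
      unfolding u_def q'_def using q
      by (auto intro!: derivative_eq_intros poly_DERIV simp: power2_eq_square)
    have um: "((\<lambda>t. u t ^ m) has_real_derivative - (of_nat m * q' * u t ^ (m + 1))) (at t)"
      using DERIV_power[OF u, of m] by (cases m) (simp_all add: algebra_simps power2_eq_square)
    have ex: "((\<lambda>t. exp (- (c * u t))) has_real_derivative c * q' * (u t)\<^sup>2 * X) (at t)"
      unfolding X_def
      by (rule DERIV_cong, rule DERIV_fun_exp, rule DERIV_minus, rule DERIV_cmult, rule u) simp
    have "((\<lambda>t. poly p t * u t ^ m * exp (- (c * u t))) has_real_derivative
       (poly (pderiv p) t * u t ^ m + - (of_nat m * q' * u t ^ (m + 1)) * poly p t) * X
         + c * q' * (u t)\<^sup>2 * X * (poly p t * u t ^ m)) (at t)"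
      using DERIV_mult[OF DERIV_mult[OF poly_DERIV[of p t] um] ex] by (simp add: X_def)
    also have "(poly (pderiv p) t * u t ^ m + - (of_nat m * q' * u t ^ (m + 1)) * poly p t) * X
         + c * q' * (u t)\<^sup>2 * X * (poly p t * u t ^ m)
       = (poly (pderiv p) t * (poly ?e t * u t)\<^sup>2 * u t ^ m
           - of_nat m * q' * (poly ?e t * u t) * u t ^ (m + 1) * poly p t
           + c * q' * (u t)\<^sup>2 * poly p t * u t ^ m) * X"
      using q by (simp add: u_def algebra_simps)
    also have "\<dots> = poly ?p t * u t ^ (m + 2) * X"
      by (simp add: q'_def algebra_simps power_add power2_eq_square)
    also have "\<dots> = bump a b c (m + 2) ?p t"
      unfolding bump_inside[OF 1] X_def u_def ..
    finally have "((\<lambda>t. poly p t * u t ^ m * exp (- (c * u t))) has_real_derivative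
       bump a b c (m + 2) ?p t) (at t)" .
    then show ?thesis
      by (rule has_field_derivative_transform_within_open[of _ _ _ "{a<..<b}"])
         (use 1 in \<open>simp_all add: bump_inside u_def\<close>)
  next
    case 2
    obtain K where "\<forall>t. \<bar>bump a b c m p t\<bar> \<le> K * (t - a)\<^sup>2 \<and> \<bar>bump a b c m p t\<bar> \<le> K * (t - b)\<^sup>2"
      using bump_quadratic_bound[OF assms] by blast
    then have "(bump a b c m p has_real_derivative 0) (at t)"
      using 2 by (auto intro: has_derivative_zero_if_quadratic_bound)
    moreover have "bump a b c (m + 2) ?p t = 0" using 2 by (intro bump_outside) auto
    ultimately show ?thesis by (simp only:)
  next
    case 3
    have "((\<lambda>_. 0) has_real_derivative 0) (at t)" by simp
    then have "(bump a b c m p has_real_derivative 0) (at t)"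
      by (rule has_field_derivative_transform_within_open[of _ _ _ "- {a..b}"])
         (use 3 in \<open>auto simp: bump_outside open_Compl\<close>)
    moreover have "bump a b c (m + 2) ?p t = 0" using 3 by (intro bump_outside) auto
    ultimately show ?thesis by (simp only:)
  qed
qed

section \<open>The fundamental lemma of the calculus of variations\<close>

definition bump_family :: "('d \<Rightarrow> real \<Rightarrow> real) \<Rightarrow> bool" where
  "bump_family g \<longleftrightarrow> (\<forall>i. \<exists>a b c m p. c > 0 \<and> g i = bump a b c m p)"

text \<open>
  Functions of this form have partial derivatives of this form, so \<open>Ck\<close> follows by an induction that
  never leaves the class.
\<close>

definition tensor :: "('d::finite \<Rightarrow> real \<Rightarrow> real) \<Rightarrow> real^'d \<Rightarrow> real" where
  "tensor g x = (\<Prod>i\<in>UNIV. g i (vec_nth x i))"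

lemma bump_familyI: "(\<And>i. c i > 0) \<Longrightarrow> bump_family (\<lambda>i. bump (a i) (b i) (c i) (m i) (p i))"
  unfolding bump_family_def by blast

text \<open>
  Stated with a choice of derivatives \<open>D i\<close> for which replacing the factor \<open>g i\<close> stays in the family; this is
  what a partial derivative of the tensor product does.
\<close>

lemma bump_family_deriv:
  assumes "bump_family g"
  shows "\<exists>D. \<forall>i. bump_family (g(i := D i)) \<and> (\<forall>t. (g i has_real_derivative D i t) (at t))"
proof -
  have "\<exists>d. bump_family (g(i := d)) \<and> (\<forall>t. (g i has_real_derivative d t) (at t))" for i
  proof -
    obtain a b c m p where g: "c > 0" "g i = bump a b c m p"
      using assms unfolding bump_family_def by blast
    let ?d = "bump a b c (m + 2) (pderiv p * edge_poly a b ^ 2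
      - of_nat m * p * pderiv (edge_poly a b) * edge_poly a b
      + Polynomial.smult c (p * pderiv (edge_poly a b)))"
    have "\<forall>t. (g i has_real_derivative ?d t) (at t)"
      unfolding g(2) by (intro allI bump_has_derivative g(1))
    moreover have "bump_family (g(i := ?d))"
      unfolding bump_family_def
    proof
      fix j
      show "\<exists>a b c m p. c > 0 \<and> (g(i := ?d)) j = bump a b c m p"
      proof (cases "j = i")
        case True
        then have "(g(i := ?d)) j = ?d" by simp
        with g(1) show ?thesis by blast
      next
        case False
        then have "(g(i := ?d)) j = g j" by simp
        then show ?thesis using assms unfolding bump_family_def by simp
      qed
    qed
    ultimately show ?thesis by blast
  qed
  then show ?thesis by metis
qed

lemma tensor_has_derivative:
  assumes "\<And>i. (g i has_real_derivative D i (vec_nth x i)) (at (vec_nth x i))"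
  shows "(tensor g has_derivative (\<lambda>y. \<Sum>i\<in>UNIV. (D i (vec_nth x i) * vec_nth y i) * (\<Prod>j\<in>UNIV - {i}. g j (vec_nth x j)))) (at x)"
  unfolding tensor_def[abs_def]
proof (rule has_derivative_prod)
  fix i
  have "((\<lambda>x. vec_nth x i) has_derivative (\<lambda>y. vec_nth y i)) (at x)"
    by (rule bounded_linear_imp_has_derivative) (rule bounded_linear_vec_nth)
  moreover have "(g i has_derivative (*) (D i (vec_nth x i))) (at (vec_nth x i))"
    using assms[of i] by (simp add: has_field_derivative_def)
  ultimately show "((\<lambda>x. g i (vec_nth x i)) has_derivative (\<lambda>y. D i (vec_nth x i) * vec_nth y i)) (at x)"
    by (rule has_derivative_compose)
qed

lemma partial_deriv_tensor:
  assumes "\<And>i t. (g i has_real_derivative D i t) (at t)"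
  shows "partial_deriv i (tensor g) = tensor (g(i := D i))"
proof
  fix x
  have "partial_deriv i (tensor g) x
      = (\<Sum>j\<in>UNIV. (D j (vec_nth x j) * vec_nth (axis i 1) j) * (\<Prod>k\<in>UNIV - {j}. g k (vec_nth x k)))"
    unfolding partial_deriv_def
    by (simp only: frechet_derivative_at[OF tensor_has_derivative[of g D x, OF assms], symmetric])
  also have "\<dots> = (\<Sum>j\<in>UNIV. if j = i then D j (vec_nth x j) * (\<Prod>k\<in>UNIV - {j}. g k (vec_nth x k)) else 0)"
    by (rule sum.cong) (auto simp: axis_def)
  also have "\<dots> = D i (vec_nth x i) * (\<Prod>k\<in>UNIV - {i}. g k (vec_nth x k))"
    by simp
  also have "\<dots> = tensor (g(i := D i)) x"
    unfolding tensor_def by (subst prod.remove[of UNIV i]) auto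
  finally show "partial_deriv i (tensor g) x = tensor (g(i := D i)) x" .
qed

lemma tensor_differentiable:
  assumes "bump_family g"
  shows "tensor g differentiable (at x)"
proof -
  obtain D where D: "\<And>i t. (g i has_real_derivative D i t) (at t)"
    using bump_family_deriv[OF assms] by metis
  show ?thesis
    by (rule differentiableI, rule tensor_has_derivative) (rule D)
qed

lemma Ck_tensor:
  assumes "bump_family g"
  shows "Ck k (tensor g)"
  using assms
proof (induction k arbitrary: g)
  case 0
  have "tensor g differentiable (at x)" for x
    by (rule tensor_differentiable) (rule 0)
  then have "continuous (at x) (tensor g)" for x
    by (rule differentiable_imp_continuous_within)
  then show ?case by (simp add: continuous_at_imp_continuous_on)
next
  case (Suc k)
  obtain D where D: "\<And>i t. (g i has_real_derivative D i t) (at t)"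
      "\<And>i. bump_family (g(i := D i))"
    using bump_family_deriv[OF Suc.prems] by metis
  have "tensor g differentiable (at x)" for x
    by (rule tensor_differentiable) (rule Suc.prems)
  moreover have "Ck k (partial_deriv i (tensor g))" for i
    unfolding partial_deriv_tensor[of g D, OF D(1)] by (rule Suc.IH) (rule D(2))
  ultimately show ?case by simp
qed

text \<open>
  With \<open>m = 0\<close> and \<open>p = 1\<close> the factors are \<open>exp (- 1 / ((n + 1) q))\<close>: they lie between \<open>0\<close> and \<open>1\<close> and
  increase to \<open>1\<close> inside the interval.
\<close>

definition box_bump :: "nat \<Rightarrow> real^'d \<Rightarrow> real^'d \<Rightarrow> real^'d::finite \<Rightarrow> real" where
  "box_bump n a b = tensor (\<lambda>i. bump (vec_nth a i) (vec_nth b i) (1 / real (Suc n)) 0 1)"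

lemma bump_unit_interval: "0 \<le> bump a b (1 / real (Suc n)) 0 1 t" "bump a b (1 / real (Suc n)) 0 1 t \<le> 1"
  by (auto simp: bump_def)

lemma box_bump_outside:
  assumes "x \<notin> box a b"
  shows "box_bump n a b x = 0"
proof -
  obtain i where "\<not> (vec_nth a i < vec_nth x i \<and> vec_nth x i < vec_nth b i)"
    using assms unfolding mem_box_cart by blast
  then have "bump (vec_nth a i) (vec_nth b i) (1 / real (Suc n)) 0 1 (vec_nth x i) = 0"
    by (rule bump_outside)
  then show ?thesis
    unfolding box_bump_def tensor_def by (intro prod_zero) auto
qed

lemma box_bump_unit_interval: "0 \<le> box_bump n a b x" "box_bump n a b x \<le> 1"
  unfolding box_bump_def tensor_def by (intro prod_nonneg prod_le_1 conjI bump_unit_interval)+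

lemma box_bump_tendsto:
  fixes x :: "real^'d::finite"
  shows "(\<lambda>n. box_bump n a b x) \<longlonglongrightarrow> indicator (box a b) x"
proof (cases "x \<in> box a b")
  case True
  have "(\<lambda>n. bump (vec_nth a i) (vec_nth b i) (1 / real (Suc n)) 0 1 (vec_nth x i)) \<longlonglongrightarrow> 1" for i
  proof -
    have i: "vec_nth a i < vec_nth x i" "vec_nth x i < vec_nth b i"
      using True by (auto simp: mem_box_cart)
    define u where "u = inverse (poly (edge_poly (vec_nth a i) (vec_nth b i)) (vec_nth x i))"
    have "(\<lambda>n. 1 / real (Suc n)) \<longlonglongrightarrow> 0"
      using LIMSEQ_inverse_real_of_nat by (simp add: inverse_eq_divide)
    then have "(\<lambda>n. exp (- (1 / real (Suc n) * u))) \<longlonglongrightarrow> exp (- (0 * u))"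
      by (intro tendsto_intros)
    then show ?thesis by (simp add: bump_inside[OF i] u_def)
  qed
  then have "(\<lambda>n. box_bump n a b x) \<longlonglongrightarrow> (\<Prod>i\<in>(UNIV::'d set). 1)"
    unfolding box_bump_def tensor_def by (intro tendsto_prod)
  then show ?thesis using True by simp
qed (simp add: box_bump_outside)

lemma test_fun_box_bump:
  assumes "cbox a b \<subseteq> \<Omega>"
  shows "test_fun \<Omega> (box_bump n a b)"
proof -
  have "bump_family (\<lambda>i. bump (vec_nth a i) (vec_nth b i) (1 / real (Suc n)) 0 1)"
    by (rule bump_familyI) simp
  then have "\<forall>k. Ck k (box_bump n a b)"
    unfolding box_bump_def by (intro allI Ck_tensor)
  moreover have "box_bump n a b x = 0" if "x \<notin> cbox a b" for x
    using that box_subset_cbox[of a b] by (intro box_bump_outside) blast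
  ultimately show ?thesis
    unfolding test_fun_def using assms compact_cbox[of a b]
    by (intro conjI exI[of _ "cbox a b"] allI impI) (auto simp only:)
qed

lemma integrable_indicator_cbox_times:
  assumes "sq_integrable u"
  shows "integrable lebesgue (\<lambda>x. indicator (cbox a b) x * u x)"
proof (rule sq_integrable_mult[OF _ assms])
  have "integrable lebesgue (indicat_real (cbox a b))"
    by (rule integrable_real_indicator) (use emeasure_lborel_cbox_finite[of a b] in \<open>auto simp: less_top\<close>)
  moreover have "(indicat_real (cbox a b) x)\<^sup>2 = indicator (cbox a b) x" for x
    by (simp add: indicator_def)
  ultimately show "sq_integrable (indicat_real (cbox a b))"
    unfolding sq_integrable_def by auto
qed

text \<open>
  Dominated convergence: the box bumps are admissible test functions and converge to the indicator of the box.
\<close>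

lemma integral_box_zero:
  fixes u :: "real^'d::finite \<Rightarrow> real"
  assumes "open \<Omega>" "sq_integrable u"
    and test: "\<And>\<phi>. test_fun \<Omega> \<phi> \<Longrightarrow> integral\<^sup>L (lebesgue_on \<Omega>) (\<lambda>x. u x * \<phi> x) = 0"
    and sub: "cbox a b \<subseteq> \<Omega>"
  shows "integral\<^sup>L lebesgue (\<lambda>x. indicator (box a b) x * u x) = 0"
proof -
  have \<Omega>: "\<Omega> \<inter> space lebesgue \<in> sets lebesgue" using assms(1) by auto
  have u [measurable]: "u \<in> borel_measurable lebesgue" using assms(2) by (simp add: sq_integrable_def)
  have bm: "box_bump n a b \<in> borel_measurable lebesgue" for n
  proof -
    have "Ck 0 (box_bump n a b)" using test_fun_box_bump[OF sub] by (auto simp: test_fun_def)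
    then have "box_bump n a b \<in> borel_measurable borel"
      by (intro borel_measurable_continuous_onI) simp
    then show ?thesis by (intro measurable_completion) simp
  qed
  have 0: "integral\<^sup>L lebesgue (\<lambda>x. box_bump n a b x * u x) = 0" for n
  proof -
    have "0 = integral\<^sup>L lebesgue (\<lambda>x. indicator \<Omega> x *\<^sub>R (u x * box_bump n a b x))"
      using test[OF test_fun_box_bump[OF sub]] integral_restrict_space[OF \<Omega>] by metis
    also have "\<dots> = integral\<^sup>L lebesgue (\<lambda>x. box_bump n a b x * u x)"
      using sub box_subset_cbox[of a b] box_bump_outside[of _ a b n]
      by (intro Bochner_Integration.integral_cong) (auto simp: indicator_def)
    finally show ?thesis by simp
  qed
  have "(\<lambda>n. integral\<^sup>L lebesgue (\<lambda>x. box_bump n a b x * u x))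
      \<longlonglongrightarrow> integral\<^sup>L lebesgue (\<lambda>x. indicator (box a b) x * u x)"
  proof (rule integral_dominated_convergence)
    show "integrable lebesgue (\<lambda>x. norm (indicator (cbox a b) x * u x))"
      by (intro integrable_norm integrable_indicator_cbox_times assms)
    show "(\<lambda>x. indicator (box a b) x * u x) \<in> borel_measurable lebesgue"
      by (intro borel_measurable_times borel_measurable_indicator u) auto
    show "(\<lambda>x. box_bump n a b x * u x) \<in> borel_measurable lebesgue" for n
      by (intro borel_measurable_times bm u)
    show "AE x in lebesgue. (\<lambda>n. box_bump n a b x * u x) \<longlonglongrightarrow> indicator (box a b) x * u x"
      by (intro always_eventually allI tendsto_mult tendsto_const box_bump_tendsto)
    have "norm (box_bump n a b x * u x) \<le> norm (indicator (cbox a b) x * u x)" for n x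
    proof (cases "x \<in> box a b")
      case True
      then have "x \<in> cbox a b" using box_subset_cbox by blast
      then show ?thesis
        using box_bump_unit_interval[of n a b x] by (simp add: abs_mult mult_left_le_one_le)
    qed (simp add: box_bump_outside)
    then show "AE x in lebesgue. norm (box_bump n a b x * u x) \<le> norm (indicator (cbox a b) x * u x)" for n
      by simp
  qed
  then show ?thesis unfolding 0 by (simp add: LIMSEQ_const_iff)
qed


text \<open>
  Boxes form an intersection-stable generator of the Borel sets. Hence the vanishing of the integral over boxes
  spreads to all Borel sets by Dynkin's argument, and a function with vanishing integrals over all sets is zero almost everywhere.
\<close>

lemma ae_zero_on_cbox:
  fixes u :: "real^'d::finite \<Rightarrow> real"
  assumes "open \<Omega>" "sq_integrable u"
    and test: "\<And>\<phi>. test_fun \<Omega> \<phi> \<Longrightarrow> integral\<^sup>L (lebesgue_on \<Omega>) (\<lambda>x. u x * \<phi> x) = 0"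
    and sub: "cbox c d \<subseteq> \<Omega>"
  shows "AE x in lebesgue. x \<in> cbox c d \<longrightarrow> u x = 0"
proof -
  define f where "f = (\<lambda>x. indicator (box c d) x * u x)"
  have u: "u \<in> borel_measurable lebesgue" using assms(2) by (simp add: sq_integrable_def)
  have f_meas: "f \<in> borel_measurable lebesgue"
    unfolding f_def by (intro borel_measurable_times borel_measurable_indicator u) auto
  have f_int: "integrable lebesgue f"
  proof (rule Bochner_Integration.integrable_bound[OF integrable_indicator_cbox_times[OF assms(2)] f_meas])
    show "AE x in lebesgue. norm (f x) \<le> norm (indicator (cbox c d) x * u x)"
      using box_subset_cbox[of c d] by (auto simp: f_def indicator_def)
  qed
  (* A Borel version, because the Dynkin argument runs over Borel sets only. *)
  obtain g where g: "g \<in> borel_measurable lborel" "AE x in lborel. f x = g x"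
    using completion_ex_borel_measurable_real[OF f_meas] by blast
  have fg: "AE x in lebesgue. f x = g x" using g(2) by (rule AE_completion)
  have g_meas: "g \<in> borel_measurable lebesgue" using g(1) by (rule measurable_completion)
  have g_int: "integrable lborel g"
    using f_int integrable_cong_AE[OF f_meas g_meas fg] integrable_completion[OF g(1)] by simp
  have set_int: "set_integrable lborel A g" if "A \<in> sets lborel" for A
    unfolding set_integrable_def using that g_int by (rule integrable_mult_indicator)
  have g_box: "(LINT x:box a b|lborel. g x) = 0" for a b
  proof -
    obtain p q where pq: "box a b \<inter> box c d = box p q" by (rule that[OF box_Int_box])
    have "(LINT x:box a b|lborel. g x) = integral\<^sup>L lebesgue (\<lambda>x. indicator (box a b) x *\<^sub>R g x)"
      unfolding set_lebesgue_integral_def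
      by (rule integral_completion[symmetric]) (use g(1) in measurable)
    also have "\<dots> = integral\<^sup>L lebesgue (\<lambda>x. indicator (box a b) x *\<^sub>R f x)"
    proof (rule integral_cong_AE)
      show "AE x in lebesgue. indicator (box a b) x *\<^sub>R g x = indicator (box a b) x *\<^sub>R f x"
        using fg by eventually_elim simp
    qed (intro borel_measurable_scaleR borel_measurable_indicator f_meas g_meas; simp)+
    also have "\<dots> = integral\<^sup>L lebesgue (\<lambda>x. indicator (box p q) x * u x)"
      by (rule Bochner_Integration.integral_cong) (auto simp: f_def indicator_def simp flip: pq)
    also have "\<dots> = 0"
    proof (cases "box p q = {}")
      case False
      have "closure (box p q) \<subseteq> closure (box c d)" by (rule closure_mono) (use pq in blast)
      moreover have "box c d \<noteq> {}" using False pq by blast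
      ultimately have "cbox p q \<subseteq> \<Omega>" using False sub by (simp add: closure_box)
      then show ?thesis by (intro integral_box_zero[OF assms(1,2) test])
    qed simp
    finally show ?thesis .
  qed
  have g_total: "(LINT x:UNIV|lborel. g x) = 0"
  proof -
    have "(LINT x:UNIV|lborel. g x) = integral\<^sup>L lebesgue g"
      unfolding set_lebesgue_integral_def using integral_completion[OF g(1)] by simp
    also have "\<dots> = integral\<^sup>L lebesgue f"
      by (rule integral_cong_AE[OF g_meas f_meas]) (use fg in eventually_elim, simp)
    also have "\<dots> = 0"
      unfolding f_def by (rule integral_box_zero[OF assms(1,2) test sub])
    finally show ?thesis .
  qed
  have "(LINT x:A|lborel. g x) = 0" if "A \<in> sets lborel" for A
  proof -
    have "Int_stable (range (\<lambda>(a, b). box a b :: (real^'d) set))"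
      by (auto simp: Int_stable_def box_Int_box)
    moreover have "range (\<lambda>(a, b). box a b :: (real^'d) set) \<subseteq> Pow UNIV" by simp
    moreover have "A \<in> sigma_sets UNIV (range (\<lambda>(a, b). box a b :: (real^'d) set))"
      using that by (simp add: borel_eq_box)
    ultimately show ?thesis
    proof (induction rule: sigma_sets_induct_disjoint[consumes 3, case_names basic empty compl union])
      case (basic A)
      then show ?case using g_box by auto
    next
      case empty
      show ?case by (simp add: set_lebesgue_integral_def)
    next
      case (compl A)
      then have A: "A \<in> sets lborel" by (simp add: borel_eq_box)
      have "(LINT x:(UNIV - A) \<union> A|lborel. g x) = (LINT x:UNIV - A|lborel. g x) + (LINT x:A|lborel. g x)"
        using A by (intro set_integral_Un set_int) auto
      with compl g_total show ?case by simp
    next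
      case (union A)
      then have A: "\<And>i. A i \<in> sets lborel" by (auto simp: borel_eq_box)
      have "(LINT x:(\<Union>i. A i)|lborel. g x) = (\<Sum>i. (LINT x:A i|lborel. g x))"
        using union(1) A by (intro lebesgue_integral_countable_add set_int) (auto simp: disjoint_family_on_def)
      with union(3) show ?case by simp
    qed
  qed
  then have "AE x in lborel. g x = 0"
    using density_unique_real[OF g_int, of "\<lambda>_. 0"] by (simp add: set_lebesgue_integral_def)
  then have "AE x in lebesgue. g x = 0" by (rule AE_completion)
  moreover have "AE x in lebesgue. x \<notin> cbox c d - box c d"
    by (rule AE_not_in) (simp add: negligible_iff_null_sets[symmetric] negligible_frontier_interval)
  ultimately show ?thesis
    using fg by eventually_elim (auto simp: f_def)
qed

text \<open>
  An open set is a countable union of boxes, so the local statement suffices.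
\<close>

lemma fundamental_lemma:
  fixes u :: "real^'d::finite \<Rightarrow> real"
  assumes "open \<Omega>" "sq_integrable u"
    and test: "\<And>\<phi>. test_fun \<Omega> \<phi> \<Longrightarrow> integral\<^sup>L (lebesgue_on \<Omega>) (\<lambda>x. u x * \<phi> x) = 0"
  shows "AE x in lebesgue. x \<in> \<Omega> \<longrightarrow> u x = 0"
proof -
  obtain \<D> where \<D>: "countable \<D>" "\<D> \<subseteq> Pow \<Omega>" "\<And>X. X \<in> \<D> \<Longrightarrow> \<exists>a b. X = cbox a b" "\<Union>\<D> = \<Omega>"
    using open_countable_Union_open_cbox[OF assms(1)] by blast
  have "AE x in lebesgue. \<forall>X\<in>\<D>. x \<in> X \<longrightarrow> u x = 0"
  proof (rule AE_ball_countable')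
    fix X assume "X \<in> \<D>"
    then obtain a b where "X = cbox a b" "cbox a b \<subseteq> \<Omega>" using \<D>(2,3) by blast
    then show "AE x in lebesgue. x \<in> X \<longrightarrow> u x = 0"
      using ae_zero_on_cbox[OF assms(1,2) test] by simp
  qed (rule \<D>(1))
  then show ?thesis
    by eventually_elim (use \<D>(4) in blast)
qed

section \<open>Linearity of weak derivatives and of the form domain\<close>

lemma subspace_L2_on: "subspace (L2_on \<Omega>)"
proof (rule subspaceI)
  show "0 \<in> L2_on \<Omega>"
    unfolding L2_on_def using rep_zero by (auto elim: eventually_mono)
next
  fix f g assume "f \<in> L2_on \<Omega>" "g \<in> L2_on \<Omega>"
  then have "AE x in lebesgue. x \<notin> \<Omega> \<longrightarrow> rep_L2 f x = 0" "AE x in lebesgue. x \<notin> \<Omega> \<longrightarrow> rep_L2 g x = 0"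
    by (simp_all add: L2_on_def)
  then have "AE x in lebesgue. x \<notin> \<Omega> \<longrightarrow> rep_L2 (f + g) x = 0"
    using rep_plus[of f g] by eventually_elim simp
  then show "f + g \<in> L2_on \<Omega>" by (simp add: L2_on_def)
next
  fix c f assume "f \<in> L2_on \<Omega>"
  then have "AE x in lebesgue. x \<notin> \<Omega> \<longrightarrow> rep_L2 f x = 0" by (simp add: L2_on_def)
  then have "AE x in lebesgue. x \<notin> \<Omega> \<longrightarrow> rep_L2 (c *\<^sub>R f) x = 0"
    using rep_scaleR[of c f] by eventually_elim simp
  then show "c *\<^sub>R f \<in> L2_on \<Omega>" by (simp add: L2_on_def)
qed

lemma sq_integrable_compact_support:
  fixes f :: "'a::euclidean_space \<Rightarrow> real"
  assumes "continuous_on UNIV f" "compact K" "\<And>x. x \<notin> K \<Longrightarrow> f x = 0"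
  shows "sq_integrable f"
proof -
  have meas: "f \<in> borel_measurable borel"
    using assms(1) by (rule borel_measurable_continuous_onI)
  have "integrable lborel (\<lambda>x. indicator K x *\<^sub>R (f x)\<^sup>2)"
    by (rule borel_integrable_compact[OF assms(2)])
      (intro continuous_intros continuous_on_subset[OF assms(1)] subset_UNIV)
  moreover have "(\<lambda>x. indicator K x *\<^sub>R (f x)\<^sup>2) = (\<lambda>x. (f x)\<^sup>2)"
    using assms(3) by (auto simp: fun_eq_iff indicator_def)
  ultimately have "integrable lborel (\<lambda>x. (f x)\<^sup>2)" by (simp only:)
  moreover have "(\<lambda>x. (f x)\<^sup>2) \<in> borel_measurable lborel" using meas by simp
  ultimately have "integrable lebesgue (\<lambda>x. (f x)\<^sup>2)" by (simp add: integrable_completion)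
  moreover have "f \<in> borel_measurable lebesgue" by (intro measurable_completion) (simp add: meas)
  ultimately show ?thesis by (simp add: sq_integrable_def)
qed

text \<open>
  Makes all integrals in the definition of a weak derivative integrals of products of square integrable
  functions, so that they are additive in the class.
\<close>

lemma sq_integrable_test_fun:
  assumes "test_fun \<Omega> \<phi>"
  shows "sq_integrable \<phi>" "sq_integrable (partial_deriv i \<phi>)"
proof -
  from assms obtain K where K: "compact K" "\<And>x. x \<notin> K \<Longrightarrow> \<phi> x = 0" and "Ck 0 \<phi>" "Ck (Suc 0) \<phi>"
    unfolding test_fun_def by blast
  then have cont: "continuous_on UNIV \<phi>" "continuous_on UNIV (partial_deriv i \<phi>)" by auto
  from cont(1) K show "sq_integrable \<phi>" by (rule sq_integrable_compact_support)
  have "partial_deriv i \<phi> x = 0" if "x \<notin> K" for x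
  proof -
    have "((\<lambda>_. 0::real) has_derivative (\<lambda>_. 0)) (at x)" by simp
    then have "(\<phi> has_derivative (\<lambda>_. 0)) (at x)"
      by (rule has_derivative_transform_within_open[of _ _ _ _ "- K"])
        (use that K compact_imp_closed[OF K(1)] in auto)
    from frechet_derivative_at[OF this] show ?thesis
      unfolding partial_deriv_def by metis
  qed
  with cont(2) K(1) show "sq_integrable (partial_deriv i \<phi>)" by (rule sq_integrable_compact_support)
qed

lemma integrable_lebesgue_on_mult:
  assumes "open \<Omega>" "sq_integrable f" "sq_integrable g"
  shows "integrable (lebesgue_on \<Omega>) (\<lambda>x. f x * g x)"
proof -
  have "\<Omega> \<inter> space lebesgue \<in> sets lebesgue" using assms(1) by auto
  moreover have "integrable lebesgue (\<lambda>x. indicator \<Omega> x *\<^sub>R (f x * g x))"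
    by (rule integrable_mult_indicator) (use assms(1) sq_integrable_mult[OF assms(2,3)] in auto)
  ultimately show ?thesis by (simp only: integrable_restrict_space)
qed

lemma AE_lebesgue_on: "AE x in lebesgue. P x \<Longrightarrow> open \<Omega> \<Longrightarrow> AE x in lebesgue_on \<Omega>. P x"
  by (subst AE_restrict_space_iff) (auto elim: eventually_mono)

lemma integral_rep_plus:
  assumes "open \<Omega>" "sq_integrable f"
  shows "integral\<^sup>L (lebesgue_on \<Omega>) (\<lambda>x. rep_L2 (v + w) x * f x)
    = integral\<^sup>L (lebesgue_on \<Omega>) (\<lambda>x. rep_L2 v x * f x) + integral\<^sup>L (lebesgue_on \<Omega>) (\<lambda>x. rep_L2 w x * f x)"
proof -
  note int = integrable_lebesgue_on_mult[OF assms(1) sq_integrable_rep assms(2)]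
  have "integral\<^sup>L (lebesgue_on \<Omega>) (\<lambda>x. rep_L2 (v + w) x * f x)
      = integral\<^sup>L (lebesgue_on \<Omega>) (\<lambda>x. rep_L2 v x * f x + rep_L2 w x * f x)"
  proof (rule integral_cong_AE)
    show "AE x in lebesgue_on \<Omega>. rep_L2 (v + w) x * f x = rep_L2 v x * f x + rep_L2 w x * f x"
      using AE_lebesgue_on[OF rep_plus[of v w] assms(1)] by eventually_elim (simp add: distrib_right)
  qed (intro borel_measurable_add borel_measurable_integrable int)+
  then show ?thesis by (simp add: int)
qed

lemma integral_rep_scaleR:
  assumes "open \<Omega>" "sq_integrable f"
  shows "integral\<^sup>L (lebesgue_on \<Omega>) (\<lambda>x. rep_L2 (c *\<^sub>R v) x * f x)
    = c * integral\<^sup>L (lebesgue_on \<Omega>) (\<lambda>x. rep_L2 v x * f x)"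
proof -
  note int = integrable_lebesgue_on_mult[OF assms(1) sq_integrable_rep assms(2)]
  have "integral\<^sup>L (lebesgue_on \<Omega>) (\<lambda>x. rep_L2 (c *\<^sub>R v) x * f x)
      = integral\<^sup>L (lebesgue_on \<Omega>) (\<lambda>x. c * (rep_L2 v x * f x))"
  proof (rule integral_cong_AE)
    show "AE x in lebesgue_on \<Omega>. rep_L2 (c *\<^sub>R v) x * f x = c * (rep_L2 v x * f x)"
      using AE_lebesgue_on[OF rep_scaleR[of c v] assms(1)] by eventually_elim simp
  qed (intro borel_measurable_times borel_measurable_const borel_measurable_integrable int)+
  then show ?thesis by simp
qed

lemma is_weak_partial_add:
  assumes "open \<Omega>" "is_weak_partial \<Omega> i v g" "is_weak_partial \<Omega> i w h"
  shows "is_weak_partial \<Omega> i (v + w) (g + h)"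
  using assms
  by (simp add: subspace_add[OF subspace_L2_on] is_weak_partial_def integral_rep_plus sq_integrable_test_fun)

lemma is_weak_partial_scaleR:
  assumes "open \<Omega>" "is_weak_partial \<Omega> i v g"
  shows "is_weak_partial \<Omega> i (c *\<^sub>R v) (c *\<^sub>R g)"
  using assms
  by (simp add: subspace_scale[OF subspace_L2_on] is_weak_partial_def integral_rep_scaleR sq_integrable_test_fun)

text \<open>
  The difference of two weak derivatives of \<open>v\<close> is a weak derivative of \<open>0\<close>, so its integral against
  every test function vanishes.
\<close>

lemma weak_partial_unique:
  assumes "open \<Omega>" "is_weak_partial \<Omega> i v g" "is_weak_partial \<Omega> i v h"
  shows "g = h"
proof -
  define d where "d = g + (-1) *\<^sub>R h"
  have "is_weak_partial \<Omega> i (v + (-1) *\<^sub>R v) d"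
    unfolding d_def by (intro is_weak_partial_add is_weak_partial_scaleR assms)
  (* Written with a factor 0 so that the integral over the representative of 0 is covered by homogeneity. *)
  then have "is_weak_partial \<Omega> i (0 *\<^sub>R 0) d" by simp
  then have L: "d \<in> L2_on \<Omega>"
    and "\<And>\<phi>. test_fun \<Omega> \<phi> \<Longrightarrow> integral\<^sup>L (lebesgue_on \<Omega>) (\<lambda>x. rep_L2 d x * \<phi> x) = 0"
    unfolding is_weak_partial_def
    by (simp_all add: integral_rep_scaleR[OF assms(1)] sq_integrable_test_fun del: scale_zero_left scale_zero_right scaleR_zero_left scaleR_zero_right)
  then have "AE x in lebesgue. x \<in> \<Omega> \<longrightarrow> rep_L2 d x = 0"
    by (intro fundamental_lemma[OF assms(1) sq_integrable_rep])
  moreover have "AE x in lebesgue. x \<notin> \<Omega> \<longrightarrow> rep_L2 d x = 0"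
    using L by (simp add: L2_on_def)
  ultimately have "AE x in lebesgue. rep_L2 d x = rep_L2 0 x"
    using rep_zero by eventually_elim auto
  then have "d = 0" by (rule L2_eqI)
  then show ?thesis by (simp add: d_def)
qed

lemma weak_partial_eq:
  assumes "open \<Omega>" "is_weak_partial \<Omega> i v g"
  shows "weak_partial \<Omega> i v = g"
  unfolding weak_partial_def using assms weak_partial_unique by blast

lemma weak_partial_linear:
  assumes "open \<Omega>" "v \<in> H1 \<Omega>" "w \<in> H1 \<Omega>"
  shows "weak_partial \<Omega> i (v + w) = weak_partial \<Omega> i v + weak_partial \<Omega> i w"
    and "weak_partial \<Omega> i (c *\<^sub>R v) = c *\<^sub>R weak_partial \<Omega> i v"
proof -
  obtain g h where gh: "is_weak_partial \<Omega> i v g" "is_weak_partial \<Omega> i w h"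
    using assms(2,3) unfolding H1_def by blast
  note eq = gh[THEN weak_partial_eq[OF assms(1)]]
  show "weak_partial \<Omega> i (v + w) = weak_partial \<Omega> i v + weak_partial \<Omega> i w"
    unfolding eq by (rule weak_partial_eq[OF assms(1) is_weak_partial_add[OF assms(1) gh]])
  show "weak_partial \<Omega> i (c *\<^sub>R v) = c *\<^sub>R weak_partial \<Omega> i v"
    unfolding eq by (rule weak_partial_eq[OF assms(1) is_weak_partial_scaleR[OF assms(1) gh(1)]])
qed

lemma subspace_H1:
  assumes "open \<Omega>"
  shows "subspace (H1 \<Omega>)"
proof (rule subspaceI)
  have "is_weak_partial \<Omega> i 0 0" for i
    using subspace_0[OF subspace_L2_on]
      integral_rep_scaleR[OF assms sq_integrable_test_fun(1), of \<Omega> _ 0 0]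
      integral_rep_scaleR[OF assms sq_integrable_test_fun(2), of \<Omega> _ 0 0]
    unfolding is_weak_partial_def by simp
  then show "0 \<in> H1 \<Omega>" using subspace_0[OF subspace_L2_on] unfolding H1_def by blast
next
  fix v w assume "v \<in> H1 \<Omega>" "w \<in> H1 \<Omega>"
  then show "v + w \<in> H1 \<Omega>"
    unfolding H1_def using is_weak_partial_add[OF assms] subspace_add[OF subspace_L2_on] by blast
next
  fix c v assume "v \<in> H1 \<Omega>"
  then show "c *\<^sub>R v \<in> H1 \<Omega>"
    unfolding H1_def using is_weak_partial_scaleR[OF assms] subspace_scale[OF subspace_L2_on] by blast
qed

lemma norm_H1_scaleR:
  assumes "open \<Omega>" "v \<in> H1 \<Omega>"
  shows "norm_H1 \<Omega> (c *\<^sub>R v) = \<bar>c\<bar> * norm_H1 \<Omega> v"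
proof -
  have "norm_H1 \<Omega> (c *\<^sub>R v) = sqrt (c\<^sup>2 * ((norm v)\<^sup>2 + (\<Sum>i\<in>UNIV. (norm (weak_partial \<Omega> i v))\<^sup>2)))"
    by (simp add: norm_H1_def weak_partial_linear(2)[OF assms assms(2)] power_mult_distrib
        distrib_left sum_distrib_left)
  also have "\<dots> = \<bar>c\<bar> * norm_H1 \<Omega> v"
    by (simp only: real_sqrt_mult real_sqrt_abs norm_H1_def)
  finally show ?thesis .
qed

text \<open>
  The \<open>H\<^sup>1\<close> norm is the Euclidean norm of the list of the norms of \<open>v\<close> and of its partial derivatives; the
  list is indexed by \<open>'d option\<close>, with \<open>None\<close> for \<open>v\<close> itself.
\<close>

lemma norm_H1_triangle:
  assumes "open \<Omega>" "v \<in> H1 \<Omega>" "w \<in> H1 \<Omega>"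
  shows "norm_H1 \<Omega> (v + w) \<le> norm_H1 \<Omega> v + norm_H1 \<Omega> w"
proof -
  define p where "p = (\<lambda>v k. norm (case k of None \<Rightarrow> v | Some i \<Rightarrow> weak_partial \<Omega> i v))"
  have eq: "norm_H1 \<Omega> v = L2_set (p v) UNIV" for v
    unfolding norm_H1_def L2_set_def p_def UNIV_option_conv
    by (subst sum.insert) (auto simp: sum.reindex)
  have "L2_set (p (v + w)) UNIV \<le> L2_set (\<lambda>k. p v k + p w k) UNIV"
  proof (rule L2_set_mono)
    fix k show "p (v + w) k \<le> p v k + p w k"
      by (cases k) (simp_all add: p_def weak_partial_linear(1)[OF assms] norm_triangle_ineq)
  qed (simp add: p_def)
  also have "\<dots> \<le> L2_set (p v) UNIV + L2_set (p w) UNIV" by (rule L2_set_triangle_ineq)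
  finally show ?thesis by (simp only: eq)
qed

lemma subspace_H1_bc:
  assumes "open \<Omega>"
  shows "subspace (H1_bc \<Omega> \<Gamma>)"
proof (rule subspaceI)
  note H1 = subspace_H1[OF assms]
  have near0: "vanishes_near \<Omega> \<Gamma> 0"
    unfolding vanishes_near_def
    by (rule exI[of _ UNIV]) (use rep_zero in \<open>auto elim: eventually_mono\<close>)
  have "norm_H1 \<Omega> (0 - 0) = 0"
    using norm_H1_scaleR[OF assms subspace_0[OF H1], of 0] by simp
  with near0 show "0 \<in> H1_bc \<Omega> \<Gamma>"
    unfolding H1_bc_def using subspace_0[OF H1] by force
next
  note H1 = subspace_H1[OF assms]
  fix v1 v2 assume v: "v1 \<in> H1_bc \<Omega> \<Gamma>" "v2 \<in> H1_bc \<Omega> \<Gamma>"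
  then have vH: "v1 \<in> H1 \<Omega>" "v2 \<in> H1 \<Omega>" by (simp_all add: H1_bc_def)
  have "\<exists>w\<in>H1 \<Omega>. vanishes_near \<Omega> \<Gamma> w \<and> norm_H1 \<Omega> (v1 + v2 - w) < \<epsilon>" if "\<epsilon> > 0" for \<epsilon>
  proof -
    from that have "\<epsilon> / 2 > 0" by simp
    with v obtain w1 w2 where w: "w1 \<in> H1 \<Omega>" "vanishes_near \<Omega> \<Gamma> w1" "norm_H1 \<Omega> (v1 - w1) < \<epsilon> / 2"
        "w2 \<in> H1 \<Omega>" "vanishes_near \<Omega> \<Gamma> w2" "norm_H1 \<Omega> (v2 - w2) < \<epsilon> / 2"
      unfolding H1_bc_def by blast
    obtain U1 U2 where U: "open U1" "\<Gamma> \<subseteq> U1" "AE x in lebesgue. x \<in> U1 \<inter> \<Omega> \<longrightarrow> rep_L2 w1 x = 0"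
        "open U2" "\<Gamma> \<subseteq> U2" "AE x in lebesgue. x \<in> U2 \<inter> \<Omega> \<longrightarrow> rep_L2 w2 x = 0"
      using w(2,5) unfolding vanishes_near_def by blast
    have "AE x in lebesgue. x \<in> (U1 \<inter> U2) \<inter> \<Omega> \<longrightarrow> rep_L2 (w1 + w2) x = 0"
      using U(3,6) rep_plus[of w1 w2] by eventually_elim auto
    then have "vanishes_near \<Omega> \<Gamma> (w1 + w2)"
      unfolding vanishes_near_def using U by (intro exI[of _ "U1 \<inter> U2"] conjI) auto
    moreover have "w1 + w2 \<in> H1 \<Omega>" using w subspace_add[OF H1] by blast
    moreover have "norm_H1 \<Omega> (v1 + v2 - (w1 + w2)) < \<epsilon>"
      using norm_H1_triangle[OF assms subspace_diff[OF H1 vH(1) w(1)] subspace_diff[OF H1 vH(2) w(4)]] w(3,6)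
      by (simp add: algebra_simps)
    ultimately show ?thesis by blast
  qed
  then show "v1 + v2 \<in> H1_bc \<Omega> \<Gamma>"
    unfolding H1_bc_def using subspace_add[OF H1 vH] by blast
next
  note H1 = subspace_H1[OF assms]
  fix c v assume v: "v \<in> H1_bc \<Omega> \<Gamma>"
  then have vH: "v \<in> H1 \<Omega>" by (simp add: H1_bc_def)
  have "\<exists>w\<in>H1 \<Omega>. vanishes_near \<Omega> \<Gamma> w \<and> norm_H1 \<Omega> (c *\<^sub>R v - w) < \<epsilon>" if "\<epsilon> > 0" for \<epsilon>
  proof -
    (* Dividing by |c| + 1 instead of |c| covers c = 0. *)
    from that have "\<epsilon> / (\<bar>c\<bar> + 1) > 0" by (simp add: add_nonneg_pos)
    with v obtain w where w: "w \<in> H1 \<Omega>" "vanishes_near \<Omega> \<Gamma> w" "norm_H1 \<Omega> (v - w) < \<epsilon> / (\<bar>c\<bar> + 1)"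
      unfolding H1_bc_def by blast
    obtain U where U: "open U" "\<Gamma> \<subseteq> U" "AE x in lebesgue. x \<in> U \<inter> \<Omega> \<longrightarrow> rep_L2 w x = 0"
      using w(2) unfolding vanishes_near_def by blast
    have "AE x in lebesgue. x \<in> U \<inter> \<Omega> \<longrightarrow> rep_L2 (c *\<^sub>R w) x = 0"
      using U(3) rep_scaleR[of c w] by eventually_elim auto
    then have "vanishes_near \<Omega> \<Gamma> (c *\<^sub>R w)"
      unfolding vanishes_near_def using U by blast
    moreover have "c *\<^sub>R w \<in> H1 \<Omega>" using w subspace_scale[OF H1] by blast
    moreover have "norm_H1 \<Omega> (c *\<^sub>R v - c *\<^sub>R w) < \<epsilon>"
    proof -
      have "norm_H1 \<Omega> (c *\<^sub>R v - c *\<^sub>R w) = \<bar>c\<bar> * norm_H1 \<Omega> (v - w)"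
        using norm_H1_scaleR[OF assms subspace_diff[OF H1 vH w(1)], of c] by (simp add: scaleR_diff_right)
      also have "\<dots> \<le> (\<bar>c\<bar> + 1) * norm_H1 \<Omega> (v - w)"
        by (intro mult_right_mono) (simp_all add: norm_H1_def add_nonneg_nonneg sum_nonneg)
      also have "\<dots> < \<epsilon>"
        using w(3) by (simp add: pos_less_divide_eq add_nonneg_pos mult.commute)
      finally show ?thesis .
    qed
    ultimately show ?thesis by blast
  qed
  then show "c *\<^sub>R v \<in> H1_bc \<Omega> \<Gamma>"
    unfolding H1_bc_def using subspace_scale[OF H1 vH] by blast
qed

section \<open>The smallest eigenvalue of a real symmetric matrix\<close>

definition mat_form :: "nat \<Rightarrow> (nat \<Rightarrow> nat \<Rightarrow> real) \<Rightarrow> (nat \<Rightarrow> real) \<Rightarrow> (nat \<Rightarrow> real) \<Rightarrow> real" where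
  "mat_form r g c d = (\<Sum>i<r. \<Sum>j<r. g i j * c j * d i)"

text \<open>
  Vectors are represented as functions on the natural numbers of which the first \<open>r\<close> values count; this puts
  them into a topological space in which the unit sphere is compact.
\<close>

lemma eigenvalue_mat_iff:
  fixes g :: "nat \<Rightarrow> nat \<Rightarrow> real"
  shows "eigenvalue (Matrix.mat r r (\<lambda>(i, j). g i j)) k
    \<longleftrightarrow> (\<exists>c. (\<exists>i<r. c i \<noteq> 0) \<and> (\<forall>i<r. (\<Sum>j<r. g i j * c j) = k * c i))" (is "eigenvalue ?G k \<longleftrightarrow> _")
proof -
  have row: "vec_index (?G *\<^sub>v v) i = (\<Sum>j<r. g i j * vec_index v j)" if "i < r" "v \<in> carrier_vec r" for i v
    using that by (auto simp: scalar_prod_def atLeast0LessThan intro!: sum.cong)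
  have eq_iff: "?G *\<^sub>v v = k \<cdot>\<^sub>v v \<longleftrightarrow> (\<forall>i<r. (\<Sum>j<r. g i j * vec_index v j) = k * vec_index v i)"
    if v: "v \<in> carrier_vec r" for v
  proof
    assume eq: "?G *\<^sub>v v = k \<cdot>\<^sub>v v"
    show "\<forall>i<r. (\<Sum>j<r. g i j * vec_index v j) = k * vec_index v i"
    proof (intro allI impI)
      fix i assume i: "i < r"
      have "(\<Sum>j<r. g i j * vec_index v j) = vec_index (?G *\<^sub>v v) i" by (rule row[OF i v, symmetric])
      also have "\<dots> = k * vec_index v i" unfolding eq using v i by simp
      finally show "(\<Sum>j<r. g i j * vec_index v j) = k * vec_index v i" .
    qed
  next
    assume *: "\<forall>i<r. (\<Sum>j<r. g i j * vec_index v j) = k * vec_index v i"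
    show "?G *\<^sub>v v = k \<cdot>\<^sub>v v"
    proof (rule eq_vecI)
      fix i assume "i < dim_vec (k \<cdot>\<^sub>v v)"
      then have i: "i < r" using v by simp
      show "vec_index (?G *\<^sub>v v) i = vec_index (k \<cdot>\<^sub>v v) i"
        unfolding row[OF i v] using * i v by simp
    qed (use v in simp)
  qed
  have zero_iff: "v = 0\<^sub>v r \<longleftrightarrow> (\<forall>i<r. vec_index v i = 0)" if "v \<in> carrier_vec r" for v :: "real Matrix.vec"
    using that by (auto simp: vec_eq_iff)
  have "eigenvalue ?G k \<longleftrightarrow> (\<exists>v\<in>carrier_vec r. (\<exists>i<r. vec_index v i \<noteq> 0)
      \<and> (\<forall>i<r. (\<Sum>j<r. g i j * vec_index v j) = k * vec_index v i))"
    by (auto simp: eigenvalue_def eigenvector_def eq_iff zero_iff)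
  also have "\<dots> \<longleftrightarrow> (\<exists>c. (\<exists>i<r. c i \<noteq> 0) \<and> (\<forall>i<r. (\<Sum>j<r. g i j * c j) = k * c i))"
  proof
    assume "\<exists>c. (\<exists>i<r. c i \<noteq> 0) \<and> (\<forall>i<r. (\<Sum>j<r. g i j * c j) = k * c i)"
    then obtain c where "\<exists>i<r. c i \<noteq> 0" "\<forall>i<r. (\<Sum>j<r. g i j * c j) = k * c i" by blast
    then show "\<exists>v\<in>carrier_vec r. (\<exists>i<r. vec_index v i \<noteq> 0)
      \<and> (\<forall>i<r. (\<Sum>j<r. g i j * vec_index v j) = k * vec_index v i)"
      by (intro bexI[of _ "Matrix.vec r c"]) auto
  next
    assume "\<exists>v\<in>carrier_vec r. (\<exists>i<r. vec_index v i \<noteq> 0)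
      \<and> (\<forall>i<r. (\<Sum>j<r. g i j * vec_index v j) = k * vec_index v i)"
    then obtain v where "(\<exists>i<r. vec_index v i \<noteq> 0)
      \<and> (\<forall>i<r. (\<Sum>j<r. g i j * vec_index v j) = k * vec_index v i)" by blast
    then show "\<exists>c. (\<exists>i<r. c i \<noteq> 0) \<and> (\<forall>i<r. (\<Sum>j<r. g i j * c j) = k * c i)"
      by (rule exI[of _ "vec_index v"])
  qed
  finally show ?thesis .
qed

lemma finite_eigenvalues:
  assumes "A \<in> carrier_mat n n"
  shows "finite {k. eigenvalue (A :: real Matrix.mat) k}"
proof -
  have "char_poly A \<noteq> 0"
    using degree_monic_char_poly[OF assms] by auto
  then show ?thesis
    using eigenvalue_root_char_poly[OF assms] poly_roots_finite by simp
qed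

text \<open>
  The unit sphere is a closed subset of a product of compact intervals, hence compact by Tychonoff's theorem.
  Coordinates from \<open>r\<close> on are fixed to \<open>0\<close>, which does not change the value of the form.
\<close>

lemma mat_form_min_on_sphere:
  assumes "0 < r"
  shows "\<exists>c0. (\<Sum>i<r. (c0 i)\<^sup>2) = 1 \<and> (\<forall>c. (\<Sum>i<r. (c i)\<^sup>2) = 1 \<longrightarrow> mat_form r g c0 c0 \<le> mat_form r g c c)"
proof -
  define S where "S = (\<lambda>i. if i < r then {-1..1::real} else {0})"
  define K where "K = PiE UNIV S \<inter> {c. (\<Sum>i<r. (c i)\<^sup>2) = 1}"
  have "compactin (product_topology (\<lambda>_. euclidean) UNIV) (PiE UNIV S)"
    unfolding compactin_PiE S_def by auto
  then have cube: "compact (PiE UNIV S)"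
    by (simp only: euclidean_product_topology compactin_euclidean_iff)
  have cont: "continuous_on T (\<lambda>c::nat \<Rightarrow> real. c i)" for T i
    by (rule continuous_on_subset[OF continuous_on_product_coordinates]) (rule subset_UNIV)
  have "closed {c :: nat \<Rightarrow> real. (\<Sum>i<r. (c i)\<^sup>2) = 1}"
    by (intro closed_Collect_eq continuous_on_sum continuous_on_power continuous_on_const cont)
  with cube have "compact K" unfolding K_def by (rule compact_Int_closed)
  moreover have "K \<noteq> {}"
  proof -
    have "(\<Sum>i<r. (if i = 0 then 1 else 0 :: real)\<^sup>2) = (\<Sum>i<r. if i = 0 then 1 else 0)"
      by (rule sum.cong) auto
    also have "\<dots> = 1" using assms by simp
    finally have "(\<lambda>i. if i = 0 then 1 else 0) \<in> K"
      using assms by (auto simp: K_def S_def)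
    then show ?thesis by blast
  qed
  moreover have "continuous_on K (\<lambda>c. mat_form r g c c)"
    unfolding mat_form_def by (intro continuous_on_sum continuous_on_mult continuous_on_const cont)
  ultimately have "\<exists>c0\<in>K. \<forall>c\<in>K. mat_form r g c0 c0 \<le> mat_form r g c c"
    by (rule continuous_attains_inf)
  then obtain c0 where c0: "c0 \<in> K" "\<And>c. c \<in> K \<Longrightarrow> mat_form r g c0 c0 \<le> mat_form r g c c"
    by blast
  have "mat_form r g c0 c0 \<le> mat_form r g c c" if c: "(\<Sum>i<r. (c i)\<^sup>2) = 1" for c
  proof -
    define c' where "c' = (\<lambda>i. if i < r then c i else 0)"
    have "\<bar>c i\<bar> \<le> 1" if "i < r" for i
    proof -
      have "(c i)\<^sup>2 \<le> (\<Sum>i<r. (c i)\<^sup>2)" using that by (intro member_le_sum) auto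
      then show ?thesis using c by (simp add: abs_square_le_1)
    qed
    then have "c' \<in> K" using c by (auto simp: K_def S_def c'_def abs_le_iff minus_le_iff)
    from c0(2)[OF this] show ?thesis by (simp add: mat_form_def c'_def)
  qed
  moreover have "(\<Sum>i<r. (c0 i)\<^sup>2) = 1" using c0(1) by (simp add: K_def)
  ultimately show ?thesis by blast
qed

lemma mat_form_add_scaled:
  assumes "\<And>i j. i < r \<Longrightarrow> j < r \<Longrightarrow> g i j = g j i"
  shows "mat_form r g (\<lambda>i. c i + t * d i) (\<lambda>i. c i + t * d i)
    = mat_form r g c c + 2 * t * mat_form r g c d + t\<^sup>2 * mat_form r g d d"
proof -
  have "mat_form r g d c = (\<Sum>i<r. \<Sum>j<r. g j i * c j * d i)"
    unfolding mat_form_def by (subst sum.swap) (simp add: mult_ac)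
  also have "\<dots> = mat_form r g c d"
    unfolding mat_form_def by (intro sum.cong refl) (simp add: assms)
  finally have sym: "mat_form r g d c = mat_form r g c d" .
  have "mat_form r g (\<lambda>i. c i + t * d i) (\<lambda>i. c i + t * d i)
      = mat_form r g c c + t * mat_form r g c d + t * mat_form r g d c + t\<^sup>2 * mat_form r g d d"
    unfolding mat_form_def by (simp add: algebra_simps power2_eq_square sum.distrib sum_distrib_left)
  then show ?thesis using sym by simp
qed

text \<open>
  The minimum \<open>m\<close> of the form on the unit sphere is an eigenvalue: the form \<open>g - m\<close> is nonnegative and vanishes at
  the minimiser \<open>c0\<close>, so its first variation there vanishes in every direction, in particular in the direction \<open>e\<close> of
  the eigenvalue residual. The smallest eigenvalue is therefore at most \<open>m\<close>, and it is positive because it is the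
  Rayleigh quotient of one of its eigenvectors.
\<close>

lemma min_eigenvalue_rayleigh:
  assumes sym: "\<And>i j. i < r \<Longrightarrow> j < r \<Longrightarrow> g i j = g j i"
    and pos: "\<And>c. \<exists>i<r. c i \<noteq> 0 \<Longrightarrow> 0 < mat_form r g c c"
    and r: "0 < r"
  shows "0 < min_eigenvalue (Matrix.mat r r (\<lambda>(i, j). g i j))"
    and "min_eigenvalue (Matrix.mat r r (\<lambda>(i, j). g i j)) * (\<Sum>i<r. (c i)\<^sup>2) \<le> mat_form r g c c"
proof -
  let ?G = "Matrix.mat r r (\<lambda>(i, j). g i j)"
  let ?n = "\<lambda>c::nat \<Rightarrow> real. \<Sum>i<r. (c i)\<^sup>2"
  obtain c0 where c0: "?n c0 = 1" "\<And>c. ?n c = 1 \<Longrightarrow> mat_form r g c0 c0 \<le> mat_form r g c c"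
    using mat_form_min_on_sphere[OF r] by blast
  define m where "m = mat_form r g c0 c0"
  have lower: "m * ?n c \<le> mat_form r g c c" for c
  proof (cases "?n c = 0")
    case True
    then have "\<forall>i<r. c i = 0" by (simp add: sum_nonneg_eq_0_iff)
    then show ?thesis by (simp add: mat_form_def)
  next
    case False
    then have n: "?n c > 0" using sum_nonneg[of "{..<r}" "\<lambda>i. (c i)\<^sup>2"] by fastforce
    define s where "s = sqrt (?n c)"
    have s: "s > 0" "s\<^sup>2 = ?n c" using n by (simp_all add: s_def)
    have "?n (\<lambda>i. c i / s) = 1"
      using s n by (simp add: power_divide flip: sum_divide_distrib)
    from c0(2)[OF this] have "m \<le> mat_form r g (\<lambda>i. c i / s) (\<lambda>i. c i / s)" by (simp add: m_def)
    also have "\<dots> = mat_form r g c c / s\<^sup>2"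
      by (simp add: mat_form_def power2_eq_square sum_divide_distrib)
    finally show ?thesis using s n by (simp add: pos_le_divide_eq)
  qed
  (* The eigenvalue residual at the minimiser; half the first variation in its direction is its squared norm. *)
  define e where "e = (\<lambda>i. (\<Sum>j<r. g i j * c0 j) - m * c0 i)"
  have \<beta>: "mat_form r g c0 e - m * (\<Sum>i<r. c0 i * e i) = ?n e"
  proof -
    have "mat_form r g c0 e = (\<Sum>i<r. (e i + m * c0 i) * e i)"
      unfolding mat_form_def sum_distrib_right[symmetric] by (simp add: e_def)
    then show ?thesis
      by (simp add: distrib_right sum.distrib power2_eq_square sum_distrib_left mult.assoc)
  qed
  have "?n e = 0"
  proof (rule ccontr)
    assume "?n e \<noteq> 0"
    then have n: "?n e > 0" using sum_nonneg[of "{..<r}" "\<lambda>i. (e i)\<^sup>2"] by fastforce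
    define \<gamma> where "\<gamma> = mat_form r g e e - m * ?n e"
    have \<gamma>: "\<gamma> \<ge> 0" using lower[of e] by (simp add: \<gamma>_def)
    (* A step against the direction e, short enough for the linear term of the variation to dominate. *)
    define s where "s = ?n e / (\<gamma> + 1)"
    have s: "s > 0" using n \<gamma> by (simp add: s_def)
    have sq: "?n (\<lambda>i. c0 i + (- s) * e i) = 1 - 2 * s * (\<Sum>i<r. c0 i * e i) + s\<^sup>2 * ?n e"
      unfolding c0(1)[symmetric]
      by (simp add: power2_eq_square algebra_simps sum.distrib sum_subtractf sum_distrib_left)
    have "m * ?n (\<lambda>i. c0 i + (- s) * e i) \<le> m + 2 * (- s) * mat_form r g c0 e + s\<^sup>2 * mat_form r g e e"
      using lower[of "\<lambda>i. c0 i + (- s) * e i"] mat_form_add_scaled[where r = r and g = g and c = c0 and t = "- s" and d = e, OF sym]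
      by (simp add: m_def)
    then have "0 \<le> - 2 * s * (mat_form r g c0 e - m * (\<Sum>i<r. c0 i * e i)) + s\<^sup>2 * \<gamma>"
      unfolding sq \<gamma>_def by (simp add: algebra_simps)
    then have "2 * s * ?n e \<le> s * (s * \<gamma>)" unfolding \<beta> by (simp add: power2_eq_square)
    then have "2 * ?n e \<le> s * \<gamma>" using s by simp
    moreover have "s * \<gamma> < ?n e" using n \<gamma> by (simp add: s_def pos_divide_less_eq)
    ultimately show False using n by linarith
  qed
  then have "\<forall>i<r. e i = 0" by (simp add: sum_nonneg_eq_0_iff)
  then have "\<forall>i<r. (\<Sum>j<r. g i j * c0 j) = m * c0 i" by (simp add: e_def)
  moreover have "\<exists>i<r. c0 i \<noteq> 0" using c0(1) by (rule contrapos_pp) simp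
  ultimately have ev: "eigenvalue ?G m" unfolding eigenvalue_mat_iff by (intro exI[of _ c0] conjI)
  have fin: "finite {k. eigenvalue ?G k}" by (rule finite_eigenvalues[of _ r]) simp
  have le: "min_eigenvalue ?G \<le> m"
    unfolding min_eigenvalue_def using ev fin by (intro Min_le) auto
  have "min_eigenvalue ?G * ?n c \<le> m * ?n c"
    by (intro mult_right_mono le sum_nonneg) simp
  also note lower[of c]
  finally show "min_eigenvalue ?G * ?n c \<le> mat_form r g c c" .
  have "min_eigenvalue ?G \<in> {k. eigenvalue ?G k}"
    unfolding min_eigenvalue_def using ev fin by (intro Min_in) auto
  then obtain d where d: "\<exists>i<r. d i \<noteq> 0" "\<forall>i<r. (\<Sum>j<r. g i j * d j) = min_eigenvalue ?G * d i"
    unfolding mem_Collect_eq eigenvalue_mat_iff by blast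
  have "mat_form r g d d = (\<Sum>i<r. (\<Sum>j<r. g i j * d j) * d i)"
    by (simp add: mat_form_def sum_distrib_right)
  also have "\<dots> = min_eigenvalue ?G * ?n d"
    using d(2) by (simp add: power2_eq_square sum_distrib_left mult.assoc)
  finally have "0 < min_eigenvalue ?G * ?n d" using pos[OF d(1)] by simp
  moreover have "0 \<le> ?n d" by (simp add: sum_nonneg)
  ultimately show "0 < min_eigenvalue ?G" by (auto simp: zero_less_mult_iff)
qed

section \<open>Forms with an orthonormal basis of eigenvectors\<close>

text \<open>
  The spectral assumption carries the solvability of the variational problem: \<open>0\<close> lies outside the spectrum, so
  every \<open>f \<in> L\<close> has a solution in \<open>H\<close>, called \<open>A\<^sup>-\<^sup>1 f\<close> in the comments below.
\<close>

locale form_with_eigenbasis =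
  fixes L H :: "'v::real_inner set" and B :: "'v \<Rightarrow> 'v \<Rightarrow> real"
    and lam :: "nat \<Rightarrow> real" and \<psi> :: "nat \<Rightarrow> 'v"
  assumes subspace_H: "subspace H" and H_subset: "H \<subseteq> L"
    and inner_prod: "inner_product_on H B"
    and spectral: "spectral_setting L H B lam \<psi>"
begin

lemma B_sym: "u \<in> H \<Longrightarrow> v \<in> H \<Longrightarrow> B u v = B v u"
  and B_add_left: "u \<in> H \<Longrightarrow> v \<in> H \<Longrightarrow> w \<in> H \<Longrightarrow> B (u + v) w = B u w + B v w"
  and B_scale_left: "u \<in> H \<Longrightarrow> v \<in> H \<Longrightarrow> B (c *\<^sub>R u) v = c * B u v"
  and B_pos: "u \<in> H \<Longrightarrow> u \<noteq> 0 \<Longrightarrow> 0 < B u u"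
  using inner_prod by (auto simp: inner_product_on_def)

lemma B_zero_left: "v \<in> H \<Longrightarrow> B 0 v = 0"
  using B_scale_left[of 0 v 0] subspace_0[OF subspace_H] by simp

lemma B_nonneg: "u \<in> H \<Longrightarrow> 0 \<le> B u u"
  using B_pos[of u] B_zero_left[of u] by fastforce

lemma B_diff_left: "u \<in> H \<Longrightarrow> v \<in> H \<Longrightarrow> w \<in> H \<Longrightarrow> B (u - v) w = B u w - B v w"
  using B_add_left[of u "(-1) *\<^sub>R v" w] B_scale_left[of v w "-1"]
    subspace_scale[OF subspace_H, of v "-1"] by simp

lemma B_diff_right: "u \<in> H \<Longrightarrow> v \<in> H \<Longrightarrow> w \<in> H \<Longrightarrow> B w (u - v) = B w u - B w v"
  using B_diff_left[of u v w] B_sym subspace_diff[OF subspace_H] by metis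

lemma B_square_diff:
  assumes "u \<in> H" "v \<in> H"
  shows "B (u - v) (u - v) = B u u - 2 * B u v + B v v"
  using assms B_diff_left[of u v "u - v"] B_diff_right[of u v u] B_diff_right[of u v v]
    B_sym[of u v] subspace_diff[OF subspace_H, of u v] by simp

lemma sum_in_H: "(\<And>i. i \<in> I \<Longrightarrow> x i \<in> H) \<Longrightarrow> (\<Sum>i\<in>I. c i *\<^sub>R x i) \<in> H"
  by (intro subspace_sum[OF subspace_H] subspace_scale[OF subspace_H])

lemma B_sum_left:
  assumes "\<And>i. i \<in> I \<Longrightarrow> x i \<in> H" "w \<in> H"
  shows "B (\<Sum>i\<in>I. c i *\<^sub>R x i) w = (\<Sum>i\<in>I. c i * B (x i) w)"
  using assms
proof (induction I rule: infinite_finite_induct)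
  case (insert i I)
  have "(\<Sum>i\<in>I. c i *\<^sub>R x i) \<in> H" using insert.prems by (intro sum_in_H) auto
  moreover have "c i *\<^sub>R x i \<in> H" using insert.prems subspace_scale[OF subspace_H] by auto
  ultimately show ?case using insert by (simp add: B_add_left B_scale_left)
qed (simp_all add: B_zero_left)

lemma B_sum_right:
  assumes "\<And>i. i \<in> I \<Longrightarrow> x i \<in> H" "w \<in> H"
  shows "B w (\<Sum>i\<in>I. c i *\<^sub>R x i) = (\<Sum>i\<in>I. c i * B w (x i))"
proof -
  have "B w (\<Sum>i\<in>I. c i *\<^sub>R x i) = (\<Sum>i\<in>I. c i * B (x i) w)"
    using B_sum_left[of I x w c] B_sym[of w "\<Sum>i\<in>I. c i *\<^sub>R x i"] sum_in_H[of I x c] assms by auto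
  also have "\<dots> = (\<Sum>i\<in>I. c i * B w (x i))"
    by (rule sum.cong) (use assms B_sym in auto)
  finally show ?thesis .
qed

lemma lam_pos: "0 < lam n"
  using spectral monoD[of lam 0 n] by (fastforce simp: spectral_setting_def)

lemma spec_eq: "op_spec L H B = range lam"
  and lam_mono: "mono lam"
  and no_accumulation: "\<exists>\<epsilon>>0. finite {n. dist (lam n) x < \<epsilon>}"
  and psi_eigen: "\<psi> n \<in> eigenspace L H B (lam n)"
  and psi_orthonormal: "inner (\<psi> m) (\<psi> n) = (if m = n then 1 else 0)"
  and psi_total: "closure (span (range \<psi>)) = L"
  using spectral unfolding spectral_setting_def by blast+

lemma subspace_L: "subspace L"
proof (rule subspaceI)
  show "0 \<in> L"
    using psi_total span_zero[of "range \<psi>"] closure_subset by blast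
next
  fix f g assume "f \<in> L" "g \<in> L"
  then obtain x y where "\<And>n. x n \<in> span (range \<psi>)" "x \<longlonglongrightarrow> f"
      "\<And>n. y n \<in> span (range \<psi>)" "y \<longlonglongrightarrow> g"
    unfolding psi_total[symmetric] closure_sequential by auto
  then have "\<forall>n. x n + y n \<in> span (range \<psi>)" "(\<lambda>n. x n + y n) \<longlonglongrightarrow> f + g"
    by (auto intro: tendsto_add span_add)
  then show "f + g \<in> L"
    unfolding psi_total[symmetric] closure_sequential by (intro exI conjI)
next
  fix c f assume "f \<in> L"
  then obtain x where "\<And>n. x n \<in> span (range \<psi>)" "x \<longlonglongrightarrow> f"
    unfolding psi_total[symmetric] closure_sequential by auto
  then have "\<forall>n. c *\<^sub>R x n \<in> span (range \<psi>)" "(\<lambda>n. c *\<^sub>R x n) \<longlonglongrightarrow> c *\<^sub>R f"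
    by (auto intro: tendsto_scaleR span_scale)
  then show "c *\<^sub>R f \<in> L"
    unfolding psi_total[symmetric] closure_sequential by (intro exI conjI)
qed

lemma psi_in_H: "\<psi> n \<in> H"
  using psi_eigen[of n] by (simp add: eigenspace_def op_dom_def)


lemma eq_zero_if_orth_psi:
  assumes "f \<in> L" "\<And>n. inner f (\<psi> n) = 0"
  shows "f = 0"
proof -
  have "closed {x. inner f x = 0}"
    by (intro closed_Collect_eq continuous_intros)
  moreover have "span (range \<psi>) \<subseteq> {x. inner f x = 0}"
    using assms(2)
    by (intro span_minimal) (auto simp: subspace_def inner_add_right)
  ultimately have "L \<subseteq> {x. inner f x = 0}"
    unfolding psi_total[symmetric] by (rule closure_minimal[rotated])
  then show ?thesis using assms(1) by auto
qed

text \<open>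
  \<open>H\<close> contains the total family \<open>\<psi>\<close>, so a functional on \<open>H\<close> has at most one representing element of \<open>L\<close>. This
  makes the definite description in \<open>op\<close> meaningful.
\<close>

lemma represent_unique:
  assumes "f \<in> L" "g \<in> L" "\<And>w. w \<in> H \<Longrightarrow> inner f w = inner g w"
  shows "f = g"
  using eq_zero_if_orth_psi[of "f - g"] subspace_diff[OF subspace_L] assms psi_in_H
  by (simp add: inner_diff_left)

lemma op_eqI:
  assumes "f \<in> L" "\<And>w. w \<in> H \<Longrightarrow> B v w = inner f w"
  shows "op L H B v = f"
  unfolding op_def by (rule the_equality) (use assms represent_unique in fastforce)+

lemma op_dom_op:
  assumes "v \<in> op_dom L H B"
  shows "v \<in> H" "op L H B v \<in> L" "w \<in> H \<Longrightarrow> B v w = inner (op L H B v) w"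
proof -
  from assms obtain f where "v \<in> H" "f \<in> L" "\<And>w. w \<in> H \<Longrightarrow> B v w = inner f w"
    by (auto simp: op_dom_def)
  moreover from this have "op L H B v = f" by (intro op_eqI)
  ultimately show "v \<in> H" "op L H B v \<in> L" "w \<in> H \<Longrightarrow> B v w = inner (op L H B v) w"
    by auto
qed

lemma in_eigenspace_iff:
  "v \<in> eigenspace L H B l \<longleftrightarrow> v \<in> H \<and> (\<forall>w\<in>H. B v w = l * inner v w)"
proof
  assume "v \<in> eigenspace L H B l"
  then have "v \<in> op_dom L H B" "op L H B v = l *\<^sub>R v" by (auto simp: eigenspace_def)
  with op_dom_op[of v] show "v \<in> H \<and> (\<forall>w\<in>H. B v w = l * inner v w)" by auto
next
  assume v: "v \<in> H \<and> (\<forall>w\<in>H. B v w = l * inner v w)"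
  have "l *\<^sub>R v \<in> L" using v H_subset subspace_scale[OF subspace_L] by blast
  moreover have "\<forall>w\<in>H. B v w = inner (l *\<^sub>R v) w" using v by simp
  ultimately show "v \<in> eigenspace L H B l"
    using v op_eqI[of "l *\<^sub>R v" v] unfolding eigenspace_def op_dom_def by blast
qed

lemma B_psi: "w \<in> H \<Longrightarrow> B (\<psi> n) w = lam n * inner (\<psi> n) w"
  using psi_eigen[of n] in_eigenspace_iff by blast

lemma B_psi_right: "w \<in> H \<Longrightarrow> B w (\<psi> n) = lam n * inner w (\<psi> n)"
  using B_psi[of w n] B_sym[of w "\<psi> n"] psi_in_H by (simp add: inner_commute)

text \<open>
  Existence comes from the spectrum rather than from the Riesz representation theorem: \<open>0\<close> is not an eigenvalue \<open>lam n\<close>, so the operator maps its domain onto \<open>L\<close>.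
\<close>

lemma op_inv_solves:
  assumes "f \<in> L"
  shows "op_inv H B f \<in> H" "v \<in> H \<Longrightarrow> B (op_inv H B f) v = inner f v"
proof -
  have "0 \<notin> op_spec L H B"
    unfolding spec_eq using lam_pos by (metis imageE less_irrefl)
  then have "bij_betw (\<lambda>v. op L H B v - 0 *\<^sub>R v) (op_dom L H B) L"
    unfolding op_spec_def by blast
  then have "f \<in> (op L H B) ` (op_dom L H B)"
    using assms by (simp add: bij_betw_def)
  then obtain u where u: "u \<in> op_dom L H B" "op L H B u = f" by blast
  have *: "u \<in> H \<and> (\<forall>v\<in>H. B u v = inner f v)" using op_dom_op[OF u(1)] u(2) by auto
  have "op_inv H B f = u"
    unfolding op_inv_def
  proof (rule the_equality)
    fix u' assume u': "u' \<in> H \<and> (\<forall>v\<in>H. B u' v = inner f v)"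
    have "u' - u \<in> H" using u' * subspace_diff[OF subspace_H] by blast
    then have "B (u' - u) (u' - u) = 0" using u' * by (simp add: B_diff_left)
    then show "u' = u" using B_pos[OF \<open>u' - u \<in> H\<close>] by force
  qed (rule *)
  with * show "op_inv H B f \<in> H" "v \<in> H \<Longrightarrow> B (op_inv H B f) v = inner f v" by auto
qed

definition expansion :: "nat set \<Rightarrow> 'v \<Rightarrow> 'v" where
  "expansion N v = (\<Sum>n\<in>N. inner v (\<psi> n) *\<^sub>R \<psi> n)"

lemma expansion_in_H: "expansion N v \<in> H"
  unfolding expansion_def by (rule sum_in_H) (rule psi_in_H)

lemma inner_expansion_psi:
  "finite N \<Longrightarrow> inner (expansion N v) (\<psi> n) = (if n \<in> N then inner v (\<psi> n) else 0)"
  by (simp add: expansion_def inner_sum_left psi_orthonormal if_distrib sum.delta cong: if_cong)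

lemma expansion_add: "expansion N (u + v) = expansion N u + expansion N v"
  by (simp add: expansion_def inner_add_left scaleR_add_left sum.distrib)

lemma expansion_diff: "expansion N (u - v) = expansion N u - expansion N v"
  by (simp add: expansion_def inner_diff_left scaleR_diff_left sum_subtractf)

lemma expansion_scale: "expansion N (c *\<^sub>R v) = c *\<^sub>R expansion N v"
  by (simp add: expansion_def scaleR_sum_right)

lemma inner_expansion: "inner (expansion N v) w = (\<Sum>n\<in>N. inner v (\<psi> n) * inner w (\<psi> n))"
  unfolding expansion_def inner_sum_left by (rule sum.cong) (simp_all add: inner_commute)

lemma norm_expansion_le:
  assumes "finite N"
  shows "norm (expansion N v) \<le> norm v"
proof -
  have "inner (expansion N v) (expansion N v) = inner (expansion N v) v"
    unfolding inner_expansion[of N v "expansion N v"] inner_expansion[of N v v]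
    by (simp add: inner_expansion_psi assms)
  also have "\<dots> \<le> norm (expansion N v) * norm v" by (rule norm_cauchy_schwarz)
  finally have "norm (expansion N v) * norm (expansion N v) \<le> norm (expansion N v) * norm v"
    by (simp add: dot_square_norm power2_eq_square)
  then show ?thesis
    by (cases "norm (expansion N v) = 0") (auto simp: mult_le_cancel_left)
qed

lemma expansion_eventually_exact:
  assumes "g \<in> span (range \<psi>)"
  shows "\<exists>M. \<forall>N\<ge>M. expansion {..<N} g = g"
  using assms
proof (induction rule: span_induct_alt)
  case base
  show ?case by (simp add: expansion_def)
next
  case (step c x y)
  then obtain n M where n: "x = \<psi> n" and M: "\<forall>N\<ge>M. expansion {..<N} y = y" by blast
  have "expansion {..<N} (\<psi> n) = \<psi> n" if "N \<ge> Suc n" for N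
  proof -
    have "expansion {..<N} (\<psi> n) = (\<Sum>m\<in>{..<N}. if m = n then \<psi> m else 0)"
      unfolding expansion_def by (rule sum.cong) (auto simp: psi_orthonormal)
    then show ?thesis using that by simp
  qed
  with M n show ?case
    by (intro exI[of _ "max M (Suc n)"]) (auto simp: expansion_add expansion_scale)
qed

text \<open>
  Partial sums are contractions and reproduce finite combinations of the \<open>\<psi> n\<close> eventually. Since these combinations
  are dense, the partial sums of every \<open>f \<in> L\<close> converge.
\<close>

lemma expansion_tendsto:
  assumes "f \<in> L"
  shows "(\<lambda>N. expansion {..<N} f) \<longlonglongrightarrow> f"
proof (rule LIMSEQ_I)
  fix e :: real assume "e > 0"
  then obtain g where g: "g \<in> span (range \<psi>)" "dist g f < e / 2"
    using assms psi_total closure_approachable[of f "span (range \<psi>)"] half_gt_zero by blast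
  obtain M where M: "\<forall>N\<ge>M. expansion {..<N} g = g"
    using expansion_eventually_exact[OF g(1)] by blast
  have "norm (expansion {..<N} f - f) < e" if "N \<ge> M" for N
  proof -
    have "expansion {..<N} f - f = expansion {..<N} (f - g) + (g - f)"
      using M that by (simp add: expansion_diff)
    also have "norm \<dots> \<le> norm (f - g) + norm (g - f)"
      by (intro order_trans[OF norm_triangle_ineq] add_mono norm_expansion_le) auto
    also have "\<dots> < e" using g(2) by (simp add: dist_norm norm_minus_commute)
    finally show ?thesis .
  qed
  then show "\<exists>M. \<forall>N\<ge>M. norm (expansion {..<N} f - f) < e" by blast
qed

lemma parseval:
  assumes "f \<in> L"
  shows "(\<lambda>n. inner f (\<psi> n) * inner g (\<psi> n)) sums inner f g"
proof -
  have "(\<lambda>N. inner (expansion {..<N} f) g) \<longlonglongrightarrow> inner f g"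
    by (intro tendsto_intros expansion_tendsto assms)
  then show ?thesis by (simp add: sums_def inner_expansion)
qed

lemma B_expansion:
  assumes "finite N" "w \<in> H"
  shows "B (expansion N v) w = (\<Sum>n\<in>N. lam n * (inner v (\<psi> n) * inner w (\<psi> n)))"
  unfolding expansion_def using assms
  by (subst B_sum_left) (auto simp: psi_in_H B_psi inner_commute algebra_simps)

lemma B_minus_expansion:
  assumes "finite N" "v \<in> H"
  shows "B (v - expansion N v) (v - expansion N v) = B v v - (\<Sum>n\<in>N. lam n * (inner v (\<psi> n))\<^sup>2)"
  using assms B_square_diff[OF assms(2) expansion_in_H, of N v] B_sym[OF assms(2) expansion_in_H, of N v]
  by (simp add: B_expansion expansion_in_H inner_expansion_psi power2_eq_square)

text \<open>
  The partial sum \<open>p\<close> of the expansion is orthogonal to \<open>v - p\<close> in the form, and \<open>v - p\<close> has nonnegative energy.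
\<close>

lemma energy_bessel:
  assumes "v \<in> H"
  shows "summable (\<lambda>n. lam n * (inner v (\<psi> n))\<^sup>2)"
    and "(\<Sum>n. lam n * (inner v (\<psi> n))\<^sup>2) \<le> B v v"
proof -
  have le: "(\<Sum>n<N. lam n * (inner v (\<psi> n))\<^sup>2) \<le> B v v" for N
    using B_minus_expansion[of "{..<N}" v] B_nonneg[of "v - expansion {..<N} v"] assms
      subspace_diff[OF subspace_H assms expansion_in_H] by simp
  show "summable (\<lambda>n. lam n * (inner v (\<psi> n))\<^sup>2)"
    by (rule summableI_nonneg_bounded[OF _ le]) (simp add: less_imp_le lam_pos)
  then show "(\<Sum>n. lam n * (inner v (\<psi> n))\<^sup>2) \<le> B v v"
    by (rule suminf_le_const) (rule le)
qed

text \<open>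
  The energy that the coefficients of \<open>v\<close> do not account for.
\<close>

definition defect :: "'v \<Rightarrow> real" where
  "defect v = B v v - (\<Sum>n. lam n * (inner v (\<psi> n))\<^sup>2)"

lemma defect_nonneg: "v \<in> H \<Longrightarrow> 0 \<le> defect v"
  using energy_bessel(2) by (simp add: defect_def)

text \<open>
  The coefficients of \<open>A\<^sup>-\<^sup>1 f\<close> are those of \<open>f\<close> divided by the eigenvalues.
\<close>

lemma inner_op_inv_psi:
  assumes "f \<in> L"
  shows "lam n * inner (op_inv H B f) (\<psi> n) = inner f (\<psi> n)"
  using op_inv_solves[OF assms] B_psi_right psi_in_H by metis

text \<open>
  For \<open>u = A\<^sup>-\<^sup>1 f\<close> both \<open>B(v, u) = (f, v)\<close> and \<open>B(u, u) = (f, u)\<close> are inner products in \<open>L\<close>, and there Parseval's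
  identity holds. The terms of the energy that involve \<open>u\<close> therefore agree with the corresponding sums over the
  eigenfunctions, and only the defect of \<open>v\<close> is left.
\<close>

lemma defect_minus_op_inv:
  assumes "v \<in> H" "f \<in> L"
  shows "defect (v - op_inv H B f) = defect v"
proof -
  let ?u = "op_inv H B f"
  note u = op_inv_solves[OF assms(2)]
  have B: "B (v - ?u) (v - ?u) = B v v - 2 * inner f v + inner f ?u"
    using B_square_diff[OF assms(1) u(1)] B_sym[OF assms(1) u(1)] u assms(1) by simp
  have "lam n * (inner (v - ?u) (\<psi> n))\<^sup>2
      = lam n * (inner v (\<psi> n))\<^sup>2 - 2 * (inner f (\<psi> n) * inner v (\<psi> n))
        + inner f (\<psi> n) * inner ?u (\<psi> n)" for n
    unfolding inner_op_inv_psi[OF assms(2), symmetric]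
    by (simp add: inner_diff_left power2_eq_square algebra_simps)
  moreover have "(\<lambda>n. lam n * (inner v (\<psi> n))\<^sup>2 - 2 * (inner f (\<psi> n) * inner v (\<psi> n))
        + inner f (\<psi> n) * inner ?u (\<psi> n)) sums
      ((\<Sum>n. lam n * (inner v (\<psi> n))\<^sup>2) - 2 * inner f v + inner f ?u)"
    by (intro sums_add sums_diff sums_mult summable_sums energy_bessel parseval assms)
  ultimately show ?thesis
    unfolding defect_def B by (simp add: sums_iff)
qed

text \<open>
  The heart of the estimate, for one approximate eigenpair \<open>(z, v)\<close>. Outside \<open>N\<close> the coefficients of \<open>v\<close> are
  bounded by \<open>K\<close> times those of the residual. The two defects agree, and the one of \<open>v\<close> is absorbed because \<open>K \<ge> 1\<close>.
\<close>

lemma energy_complement_le_residual: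
  assumes v: "v \<in> H" and N: "finite N" and K: "1 \<le> K"
    and gap: "\<And>n. n \<notin> N \<Longrightarrow> lam n \<le> K * \<bar>lam n - z\<bar>"
  shows "B (v - expansion N v) (v - expansion N v) \<le> (K * residual H B z v)\<^sup>2"
proof -
  define \<rho> where "\<rho> = v - op_inv H B (z *\<^sub>R v)"
  have zv: "z *\<^sub>R v \<in> L" using v H_subset subspace_scale[OF subspace_L] by blast
  have \<rho>H: "\<rho> \<in> H"
    unfolding \<rho>_def using v op_inv_solves(1)[OF zv] subspace_diff[OF subspace_H] by blast
  have coeff: "lam n * inner \<rho> (\<psi> n) = (lam n - z) * inner v (\<psi> n)" for n
    using inner_op_inv_psi[OF zv, of n] by (simp add: \<rho>_def inner_diff_left algebra_simps)
  have coeff_le: "lam n * (inner v (\<psi> n))\<^sup>2 \<le> K\<^sup>2 * (lam n * (inner \<rho> (\<psi> n))\<^sup>2)" if "n \<notin> N" for n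
  proof -
    have ne: "0 < \<bar>lam n - z\<bar>" using gap[OF that] lam_pos[of n] by (cases "lam n = z") auto
    have "\<bar>lam n - z\<bar> * \<bar>inner v (\<psi> n)\<bar> = lam n * \<bar>inner \<rho> (\<psi> n)\<bar>"
      using arg_cong[OF coeff[of n], of abs] lam_pos[of n] by (simp add: abs_mult)
    also have "\<dots> \<le> \<bar>lam n - z\<bar> * (K * \<bar>inner \<rho> (\<psi> n)\<bar>)"
      using mult_right_mono[OF gap[OF that], of "\<bar>inner \<rho> (\<psi> n)\<bar>"] by (simp add: algebra_simps)
    finally have "\<bar>inner v (\<psi> n)\<bar> \<le> K * \<bar>inner \<rho> (\<psi> n)\<bar>" using ne by simp
    then have "\<bar>inner v (\<psi> n)\<bar>\<^sup>2 \<le> (K * \<bar>inner \<rho> (\<psi> n)\<bar>)\<^sup>2" by (rule power_mono) simp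
    then have "(inner v (\<psi> n))\<^sup>2 \<le> K\<^sup>2 * (inner \<rho> (\<psi> n))\<^sup>2" by (simp add: power_mult_distrib)
    from mult_left_mono[OF this less_imp_le[OF lam_pos[of n]]] show ?thesis
      by (simp add: algebra_simps)
  qed
  let ?a = "\<lambda>n. lam n * (inner v (\<psi> n))\<^sup>2"
  let ?b = "\<lambda>n. lam n * (inner \<rho> (\<psi> n))\<^sup>2"
  have "?a sums (\<Sum>n. ?a n)" using energy_bessel(1)[OF v] by (rule summable_sums)
  moreover have "(\<lambda>n. if n \<in> N then ?a n else 0) sums (\<Sum>n\<in>N. ?a n)"
    by (rule sums_If_finite_set[OF N])
  ultimately have "(\<lambda>n. ?a n - (if n \<in> N then ?a n else 0)) sums ((\<Sum>n. ?a n) - (\<Sum>n\<in>N. ?a n))"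
    by (rule sums_diff)
  moreover have "(\<lambda>n. K\<^sup>2 * ?b n) sums (K\<^sup>2 * (\<Sum>n. ?b n))"
    using energy_bessel(1)[OF \<rho>H] by (intro sums_mult summable_sums)
  moreover have "?a n - (if n \<in> N then ?a n else 0) \<le> K\<^sup>2 * ?b n" for n
    using coeff_le[of n] lam_pos[of n] by auto
  ultimately have "(\<Sum>n. ?a n) - (\<Sum>n\<in>N. ?a n) \<le> K\<^sup>2 * (\<Sum>n. ?b n)"
    by (rule sums_le[rotated])
  moreover have "defect v = defect \<rho>"
    unfolding \<rho>_def using defect_minus_op_inv[OF v zv] by simp
  moreover have "defect \<rho> \<le> K\<^sup>2 * defect \<rho>"
    using mult_right_mono[of 1 "K\<^sup>2" "defect \<rho>"] defect_nonneg[OF \<rho>H] K by simp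
  ultimately have "B v v - (\<Sum>n\<in>N. ?a n) \<le> K\<^sup>2 * B \<rho> \<rho>"
    unfolding defect_def by (simp add: algebra_simps)
  then show ?thesis
    using B_minus_expansion[OF N v] B_nonneg[OF \<rho>H]
    by (simp add: residual_def energy_norm_def power_mult_distrib flip: \<rho>_def)
qed

lemma finite_eigen_indices:
  assumes "finite \<Lambda>"
  shows "finite {n. lam n \<in> \<Lambda>}"
proof -
  have "finite {n. lam n = l}" for l
  proof -
    obtain \<epsilon> where "\<epsilon> > 0" "finite {n. dist (lam n) l < \<epsilon>}" using no_accumulation by blast
    then show ?thesis by (auto intro: rev_finite_subset)
  qed
  moreover have "{n. lam n \<in> \<Lambda>} = (\<Union>l\<in>\<Lambda>. {n. lam n = l})" by blast
  ultimately show ?thesis using assms by simp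
qed

text \<open>
  A bounded monotone sequence converges, and its limit would be a finite accumulation point.
\<close>

lemma lam_unbounded: "\<exists>n. M < lam n"
proof (rule ccontr)
  assume "\<nexists>n. M < lam n"
  then have "\<And>n. lam n \<le> M" by (simp add: not_less)
  with lam_mono obtain x where x: "lam \<longlonglongrightarrow> x"
    using incseq_convergent by blast
  obtain \<epsilon> where \<epsilon>: "\<epsilon> > 0" "finite {n. dist (lam n) x < \<epsilon>}" using no_accumulation by blast
  obtain N where "\<And>n. n \<ge> N \<Longrightarrow> dist (lam n) x < \<epsilon>"
    using x \<epsilon>(1) by (auto simp: lim_sequentially)
  then have "{N..} \<subseteq> {n. dist (lam n) x < \<epsilon>}" by auto
  then show False using \<epsilon>(2) finite_subset infinite_Ici by blast
qed

lemma psi_inj: "inj \<psi>"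
  by (rule injI) (metis psi_orthonormal zero_neq_one)

lemma dim_span_psi: "dim (span (\<psi> ` N)) = card N"
proof -
  have "independent (\<psi> ` N)"
  proof (rule pairwise_orthogonal_independent)
    show "pairwise real_inner_class.orthogonal (\<psi> ` N)"
      by (auto simp: pairwise_def real_inner_class.orthogonal_def psi_orthonormal)
    show "0 \<notin> \<psi> ` N"
      using psi_orthonormal by (metis imageE inner_zero_left zero_neq_one)
  qed
  then show ?thesis
    using card_image[OF inj_on_subset[OF psi_inj subset_UNIV], of N] by (simp add: dim_eq_card_independent)
qed

lemma expansion_in_span: "expansion N v \<in> span (\<psi> ` N)"
  unfolding expansion_def by (intro span_sum span_scale span_base) blast


text \<open>
  Testing the eigenvalue equation with \<open>\<psi> n\<close> shows that an eigenvector for \<open>l\<close> has no coefficient at \<open>n\<close> unless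
  \<open>lam n = l\<close>; it is then equal to its finite expansion over the remaining indices.
\<close>

lemma eigenspace_eq: "eigenspace L H B l = span (\<psi> ` {n. lam n = l})"
proof
  show "span (\<psi> ` {n. lam n = l}) \<subseteq> eigenspace L H B l"
  proof (rule span_minimal)
    show "\<psi> ` {n. lam n = l} \<subseteq> eigenspace L H B l" using psi_eigen by auto
    show "subspace (eigenspace L H B l)"
      by (rule subspaceI)
        (auto simp: in_eigenspace_iff B_zero_left B_add_left B_scale_left inner_add_left algebra_simps
          intro: subspace_0[OF subspace_H] subspace_add[OF subspace_H] subspace_scale[OF subspace_H])
  qed
  show "eigenspace L H B l \<subseteq> span (\<psi> ` {n. lam n = l})"
  proof
    fix v assume "v \<in> eigenspace L H B l"
    then have v: "v \<in> H" "\<And>w. w \<in> H \<Longrightarrow> B v w = l * inner v w" by (auto simp: in_eigenspace_iff)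
    let ?N = "{n. lam n = l}"
    have fin: "finite ?N" using finite_eigen_indices[of "{l}"] by simp
    have "inner v (\<psi> n) = 0" if "lam n \<noteq> l" for n
      using v(2)[OF psi_in_H, of n] B_psi_right[OF v(1), of n] that by simp
    then have "inner (v - expansion ?N v) (\<psi> n) = 0" for n
      using inner_expansion_psi[OF fin, of v n] by (auto simp: inner_diff_left)
    moreover have "v - expansion ?N v \<in> L"
      using H_subset subspace_diff[OF subspace_H v(1) expansion_in_H] by blast
    ultimately have "v - expansion ?N v = 0" by (intro eq_zero_if_orth_psi)
    then show "v \<in> span (\<psi> ` ?N)" using expansion_in_span[of ?N v] by simp
  qed
qed

lemma inv_subspace_eq: "inv_subspace L H B \<Lambda> = span (\<psi> ` {n. lam n \<in> \<Lambda>})"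
proof -
  have "{\<psi> \<in> op_dom L H B. \<exists>l\<in>\<Lambda>. op L H B \<psi> = l *\<^sub>R \<psi>} = (\<Union>l\<in>\<Lambda>. eigenspace L H B l)"
    unfolding eigenspace_def by blast
  also have "\<dots> = (\<Union>l\<in>\<Lambda>. span (\<psi> ` {n. lam n = l}))" by (simp only: eigenspace_eq)
  finally have eq: "inv_subspace L H B \<Lambda> = span (\<Union>l\<in>\<Lambda>. span (\<psi> ` {n. lam n = l}))"
    unfolding inv_subspace_def by simp
  have "(\<Union>l\<in>\<Lambda>. span (\<psi> ` {n. lam n = l})) \<subseteq> span (\<psi> ` {n. lam n \<in> \<Lambda>})"
    by (intro UN_least span_mono) auto
  moreover have "\<psi> ` {n. lam n \<in> \<Lambda>} \<subseteq> span (\<Union>l\<in>\<Lambda>. span (\<psi> ` {n. lam n = l}))"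
  proof
    fix x assume "x \<in> \<psi> ` {n. lam n \<in> \<Lambda>}"
    then obtain n where n: "x = \<psi> n" "lam n \<in> \<Lambda>" by blast
    have "x \<in> span (\<psi> ` {m. lam m = lam n})" unfolding n(1) by (rule span_base) blast
    with n(2) show "x \<in> span (\<Union>l\<in>\<Lambda>. span (\<psi> ` {n. lam n = l}))"
      by (intro span_base) blast
  qed
  ultimately have "span (\<Union>l\<in>\<Lambda>. span (\<psi> ` {n. lam n = l})) = span (\<psi> ` {n. lam n \<in> \<Lambda>})"
    unfolding span_eq by (rule conjI)
  with eq show ?thesis by (rule trans)
qed

lemma orth_proj_eq_expansion:
  assumes "finite N"
  shows "orth_proj (span (\<psi> ` N)) v = expansion N v"
  unfolding orth_proj_def
proof (rule the_equality)
  have "span (\<psi> ` N) \<subseteq> {w. inner (v - expansion N v) w = 0}"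
  proof (rule span_minimal)
    show "\<psi> ` N \<subseteq> {w. inner (v - expansion N v) w = 0}"
      using inner_expansion_psi[OF assms, of v] by (auto simp: inner_diff_left)
    show "subspace {w. inner (v - expansion N v) w = 0}"
      by (simp add: subspace_def inner_add_right)
  qed
  then have orth: "inner (v - expansion N v) w = 0" if "w \<in> span (\<psi> ` N)" for w
    using that by blast
  then show *: "expansion N v \<in> span (\<psi> ` N) \<and> (\<forall>w\<in>span (\<psi> ` N). inner (v - expansion N v) w = 0)"
    using expansion_in_span by blast
  fix p assume p: "p \<in> span (\<psi> ` N) \<and> (\<forall>w\<in>span (\<psi> ` N). inner (v - p) w = 0)"
  then have "p - expansion N v \<in> span (\<psi> ` N)" using expansion_in_span span_diff by blast
  then have "inner (v - expansion N v) (p - expansion N v) - inner (v - p) (p - expansion N v) = 0"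
    using p orth by simp
  then have "inner (p - expansion N v) (p - expansion N v) = 0" by (simp add: inner_diff_left)
  then show "p = expansion N v" by simp
qed

text \<open>
  Eigenvalues at distance at least \<open>\<epsilon>\<close> from \<open>z\<close> have quotient at most \<open>1 + z / \<epsilon>\<close>, and only finitely
  many are closer. Without this bound the supremum in the definition of the constant would be unspecified.
\<close>

lemma gap_const_bdd:
  assumes "z > 0"
  shows "bdd_above ((\<lambda>\<xi>. \<xi> / \<bar>\<xi> - z\<bar>) ` ((range lam - \<Lambda>) \<union> {0}))"
proof -
  obtain \<epsilon> where \<epsilon>: "\<epsilon> > 0" "finite {n. dist (lam n) z < \<epsilon>}" using no_accumulation by blast
  (* The points close to z, together with 0, which the index set of the supremum contains as well. *)
  let ?F = "lam ` {n. dist (lam n) z < \<epsilon>} \<union> {0}"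
  have far: "\<xi> / \<bar>\<xi> - z\<bar> \<le> 1 + z / \<epsilon>" if "\<epsilon> \<le> \<bar>\<xi> - z\<bar>" for \<xi>
  proof -
    have pos: "\<bar>\<xi> - z\<bar> > 0" using that \<epsilon>(1) by linarith
    have "\<xi> / \<bar>\<xi> - z\<bar> \<le> (\<bar>\<xi> - z\<bar> + z) / \<bar>\<xi> - z\<bar>" by (intro divide_right_mono) auto
    also have "\<dots> = 1 + z / \<bar>\<xi> - z\<bar>" using pos by (simp add: add_divide_distrib)
    also have "\<dots> \<le> 1 + z / \<epsilon>" using that \<epsilon>(1) assms by (intro add_left_mono divide_left_mono) auto
    finally show ?thesis .
  qed
  have "bdd_above ((\<lambda>\<xi>. \<xi> / \<bar>\<xi> - z\<bar>) ` ?F)" using \<epsilon>(2) by (intro bdd_above_finite) simp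
  moreover have "bdd_above ((\<lambda>\<xi>. \<xi> / \<bar>\<xi> - z\<bar>) ` {\<xi>. \<epsilon> \<le> \<bar>\<xi> - z\<bar>})"
    using far by (intro bdd_aboveI[of _ "1 + z / \<epsilon>"]) auto
  ultimately have "bdd_above ((\<lambda>\<xi>. \<xi> / \<bar>\<xi> - z\<bar>) ` (?F \<union> {\<xi>. \<epsilon> \<le> \<bar>\<xi> - z\<bar>}))"
    by (simp only: image_Un bdd_above_Un)
  then show ?thesis
    by (rule bdd_above_mono) (intro image_mono, auto simp: dist_real_def not_less)
qed

lemma le_gap_const:
  assumes "z > 0" "\<xi> \<in> range lam - \<Lambda>"
  shows "\<xi> / \<bar>\<xi> - z\<bar> \<le> gap_const (range lam) \<Lambda> z"
  unfolding gap_const_def using assms(2) by (intro cSUP_upper gap_const_bdd assms(1)) blast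

text \<open>
  Any eigenvalue above \<open>z\<close> and above \<open>\<Lambda>\<close> has quotient at least \<open>1\<close>.
\<close>

lemma gap_const_ge_1:
  assumes "z > 0" "finite \<Lambda>"
  shows "1 \<le> gap_const (range lam) \<Lambda> z"
proof -
  obtain n where n: "Max (insert z \<Lambda>) < lam n" using lam_unbounded by blast
  then have "z < lam n" "lam n \<notin> \<Lambda>"
    using assms(2) Max_ge[of "insert z \<Lambda>"] by (force, force)
  then have "1 \<le> lam n / \<bar>lam n - z\<bar>" using assms(1) by (simp add: pos_le_divide_eq)
  also have "\<dots> \<le> gap_const (range lam) \<Lambda> z"
    using \<open>lam n \<notin> \<Lambda>\<close> by (intro le_gap_const assms(1)) auto
  finally show ?thesis .
qed

lemma B_cauchy_schwarz:
  assumes "u \<in> H" "v \<in> H"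
  shows "\<bar>B u v\<bar> \<le> sqrt (B u u) * sqrt (B v v)"
proof (cases "v = 0")
  case True
  then show ?thesis
    using B_zero_left[OF assms(1)] B_zero_left[OF subspace_0[OF subspace_H]] B_sym[OF assms] by simp
next
  case False
  then have pos: "B v v > 0" using B_pos assms(2) by blast
  (* The minimiser of the energy of u - t v. *)
  define t where "t = B u v / B v v"
  have tv: "t *\<^sub>R v \<in> H" using subspace_scale[OF subspace_H assms(2)] .
  have "0 \<le> B (u - t *\<^sub>R v) (u - t *\<^sub>R v)"
    using B_nonneg subspace_diff[OF subspace_H assms(1) tv] by blast
  also have "\<dots> = B u u - 2 * (t * B u v) + t * (t * B v v)"
    using B_square_diff[OF assms(1) tv] B_scale_left[OF assms(2) assms(1), of t] B_scale_left[OF assms(2) tv, of t]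
      B_scale_left[OF assms(2) assms(2), of t] B_sym[OF assms(1) tv] B_sym[OF tv assms(2)] B_sym[OF assms] by simp
  also have "\<dots> = B u u - (B u v)\<^sup>2 / B v v"
    using pos by (simp add: t_def power2_eq_square)
  finally have "(B u v)\<^sup>2 \<le> B u u * B v v" using pos by (simp add: pos_divide_le_eq)
  then have "sqrt ((B u v)\<^sup>2) \<le> sqrt (B u u * B v v)" by (rule real_sqrt_le_mono)
  then show ?thesis by (simp add: real_sqrt_mult)
qed

text \<open>
  Splitting \<open>c j\<close> times the energy norm of \<open>x j\<close> with the factor \<open>sqrt (w j)\<close> before the Cauchy-Schwarz inequality is
  what allows different weights.
\<close>

lemma B_weighted_combination_le:
  assumes x: "\<And>j. j \<in> J \<Longrightarrow> x j \<in> H" and w: "\<And>j. j \<in> J \<Longrightarrow> 0 < w j"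
  shows "B (\<Sum>j\<in>J. c j *\<^sub>R x j) (\<Sum>j\<in>J. c j *\<^sub>R x j)
    \<le> (\<Sum>j\<in>J. w j * (c j)\<^sup>2) * (\<Sum>j\<in>J. B (x j) (x j) / w j)"
proof -
  let ?e = "\<lambda>j. sqrt (B (x j) (x j))"
  have "B (\<Sum>j\<in>J. c j *\<^sub>R x j) (\<Sum>j\<in>J. c j *\<^sub>R x j) = (\<Sum>i\<in>J. \<Sum>j\<in>J. c i * (c j * B (x i) (x j)))"
  proof -
    have "B (\<Sum>j\<in>J. c j *\<^sub>R x j) (\<Sum>j\<in>J. c j *\<^sub>R x j)
        = (\<Sum>i\<in>J. c i * B (x i) (\<Sum>j\<in>J. c j *\<^sub>R x j))"
      by (intro B_sum_left sum_in_H x)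
    also have "\<dots> = (\<Sum>i\<in>J. c i * (\<Sum>j\<in>J. c j * B (x i) (x j)))"
      by (intro sum.cong refl arg_cong2[where f = "(*)"] B_sum_right x)
    finally show ?thesis by (simp add: sum_distrib_left)
  qed
  also have "\<dots> \<le> (\<Sum>i\<in>J. \<Sum>j\<in>J. (\<bar>c i\<bar> * ?e i) * (\<bar>c j\<bar> * ?e j))"
  proof (intro sum_mono)
    fix i j assume ij: "i \<in> J" "j \<in> J"
    have "c i * (c j * B (x i) (x j)) \<le> \<bar>c i\<bar> * (\<bar>c j\<bar> * \<bar>B (x i) (x j)\<bar>)"
      by (metis abs_ge_self abs_mult)
    also have "\<dots> \<le> \<bar>c i\<bar> * (\<bar>c j\<bar> * (?e i * ?e j))"
      by (intro mult_left_mono B_cauchy_schwarz x ij) auto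
    finally show "c i * (c j * B (x i) (x j)) \<le> (\<bar>c i\<bar> * ?e i) * (\<bar>c j\<bar> * ?e j)"
      by (simp add: mult_ac)
  qed
  also have "\<dots> = (\<Sum>j\<in>J. \<bar>c j\<bar> * ?e j)\<^sup>2"
    by (simp add: power2_eq_square sum_product)
  also have "\<dots> = (\<Sum>j\<in>J. (sqrt (w j) * \<bar>c j\<bar>) * (?e j / sqrt (w j)))\<^sup>2"
    by (intro arg_cong[where f = "\<lambda>x. x\<^sup>2"] sum.cong) (use w in fastforce)+
  also have "\<dots> \<le> (\<Sum>j\<in>J. (sqrt (w j) * \<bar>c j\<bar>)\<^sup>2) * (\<Sum>j\<in>J. (?e j / sqrt (w j))\<^sup>2)"
    by (rule Cauchy_Schwarz_ineq_sum)
  also have "\<dots> = (\<Sum>j\<in>J. w j * (c j)\<^sup>2) * (\<Sum>j\<in>J. B (x j) (x j) / w j)"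
    using x w by (intro arg_cong2[where f = "(*)"] sum.cong)
      (auto simp: power_mult_distrib power_divide B_nonneg less_imp_le)
  finally show ?thesis .
qed

lemma expansion_sum: "expansion N (\<Sum>j\<in>J. c j *\<^sub>R x j) = (\<Sum>j\<in>J. c j *\<^sub>R expansion N (x j))"
proof (induction J rule: infinite_finite_induct)
  case (insert j J)
  then show ?case by (simp add: expansion_add expansion_scale)
qed (simp_all add: expansion_def)

text \<open>
  The form in which both subspace estimates are obtained; they differ in the choice of the weights \<open>w\<close>.
\<close>

lemma complement_of_combination_le:
  assumes N: "finite N" and x: "\<And>j. j \<in> J \<Longrightarrow> x j \<in> H" and w: "\<And>j. j \<in> J \<Longrightarrow> 0 < w j"
    and v: "v = (\<Sum>j\<in>J. c j *\<^sub>R x j)" and coercive: "(\<Sum>j\<in>J. w j * (c j)\<^sup>2) \<le> B v v"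
    and le: "\<And>j. j \<in> J \<Longrightarrow> B (x j - expansion N (x j)) (x j - expansion N (x j)) \<le> D j"
  shows "B (v - expansion N v) (v - expansion N v) \<le> (\<Sum>j\<in>J. D j / w j) * B v v"
proof -
  let ?y = "\<lambda>j. x j - expansion N (x j)"
  have y: "?y j \<in> H" if "j \<in> J" for j
    using x[OF that] subspace_diff[OF subspace_H] expansion_in_H by blast
  have eq: "v - expansion N v = (\<Sum>j\<in>J. c j *\<^sub>R ?y j)"
    unfolding v expansion_sum by (simp add: scaleR_diff_right sum_subtractf)
  have "B (v - expansion N v) (v - expansion N v)
      \<le> (\<Sum>j\<in>J. w j * (c j)\<^sup>2) * (\<Sum>j\<in>J. B (?y j) (?y j) / w j)"
    unfolding eq by (rule B_weighted_combination_le[OF y w])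
  also have "\<dots> \<le> B v v * (\<Sum>j\<in>J. D j / w j)"
  proof (rule mult_mono[OF coercive])
    show "(\<Sum>j\<in>J. B (?y j) (?y j) / w j) \<le> (\<Sum>j\<in>J. D j / w j)"
      using w le by (intro sum_mono divide_right_mono) (auto simp: less_imp_le)
    show "0 \<le> B v v" unfolding v by (intro B_nonneg sum_in_H x)
    show "0 \<le> (\<Sum>j\<in>J. B (?y j) (?y j) / w j)"
      using w y B_nonneg by (intro sum_nonneg divide_nonneg_pos) auto
  qed
  finally show ?thesis by (simp add: mult.commute)
qed

lemma bessel_finite:
  fixes x :: "'i \<Rightarrow> 'v"
  assumes "finite J" "\<And>i j. i \<in> J \<Longrightarrow> j \<in> J \<Longrightarrow> inner (x i) (x j) = (if i = j then 1 else 0)"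
  shows "(\<Sum>j\<in>J. (inner (x j) u)\<^sup>2) \<le> inner u u"
proof -
  define p where "p = (\<Sum>j\<in>J. inner (x j) u *\<^sub>R x j)"
  have up: "inner p u = (\<Sum>j\<in>J. (inner (x j) u)\<^sup>2)"
    by (simp add: p_def inner_sum_left power2_eq_square)
  have "inner p (x i) = inner (x i) u" if "i \<in> J" for i
  proof -
    have "inner p (x i) = (\<Sum>j\<in>J. if j = i then inner (x j) u else 0)"
      unfolding p_def inner_sum_left by (rule sum.cong) (use assms(2) that in auto)
    then show ?thesis using assms(1) that by simp
  qed
  moreover have "inner p p = (\<Sum>j\<in>J. inner (x j) u * inner p (x j))"
  proof -
    have "inner p p = inner p (\<Sum>j\<in>J. inner (x j) u *\<^sub>R x j)" by (simp only: p_def)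
    then show ?thesis by (simp only: inner_sum_right inner_scaleR_right)
  qed
  ultimately have pp: "inner p p = (\<Sum>j\<in>J. (inner (x j) u)\<^sup>2)"
    by (simp add: power2_eq_square)
  have "0 \<le> inner (u - p) (u - p)" by simp
  also have "\<dots> = inner u u - 2 * inner p u + inner p p"
    by (simp add: inner_diff_left inner_diff_right inner_commute)
  finally show ?thesis using up pp by simp
qed

text \<open>
  The energy of \<open>x j\<close> minus that of its complement is \<open>\<Sum>n\<in>N. lam n (x j, \<psi> n)\<^sup>2\<close>. Summed over \<open>j\<close>, the
  squares are at most \<open>1\<close> for each \<open>n\<close> by Bessel's inequality applied to the unit vector \<open>\<psi> n\<close>.
\<close>

lemma eigenvalue_sum_le:
  assumes N: "finite N" and J: "finite J" and x: "\<And>j. j \<in> J \<Longrightarrow> x j \<in> H"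
    and orth: "\<And>i j. i \<in> J \<Longrightarrow> j \<in> J \<Longrightarrow> inner (x i) (x j) = (if i = j then 1 else 0)"
  shows "(\<Sum>j\<in>J. B (x j) (x j)) - (\<Sum>n\<in>N. lam n)
    \<le> (\<Sum>j\<in>J. B (x j - expansion N (x j)) (x j - expansion N (x j)))"
proof -
  have "(\<Sum>j\<in>J. \<Sum>n\<in>N. lam n * (inner (x j) (\<psi> n))\<^sup>2) = (\<Sum>n\<in>N. lam n * (\<Sum>j\<in>J. (inner (x j) (\<psi> n))\<^sup>2))"
    by (subst sum.swap) (simp add: sum_distrib_left)
  also have "\<dots> \<le> (\<Sum>n\<in>N. lam n * 1)"
  proof (intro sum_mono mult_left_mono)
    fix n show "(\<Sum>j\<in>J. (inner (x j) (\<psi> n))\<^sup>2) \<le> 1"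
      using bessel_finite[OF J orth, of "\<psi> n"] by (simp add: psi_orthonormal)
  qed (simp add: less_imp_le lam_pos)
  finally show ?thesis
    by (simp add: B_minus_expansion[OF N x] sum_subtractf)
qed

text \<open>
  Both families take each value \<open>l \<in> \<Lambda>\<close> as often as the dimension of its eigenspace.
\<close>

lemma sum_listed_eigenvalues:
  assumes "finite \<Lambda>" "lists_eigenvalues L H B \<Lambda> r \<mu>"
  shows "(\<Sum>j=1..r. \<mu> j) = (\<Sum>n\<in>{n. lam n \<in> \<Lambda>}. lam n)"
proof -
  have \<mu>: "\<mu> ` {1..r} = \<Lambda>" "\<And>l. l \<in> \<Lambda> \<Longrightarrow> card {j \<in> {1..r}. \<mu> j = l} = card {n. lam n = l}"
    using assms(2) by (auto simp: lists_eigenvalues_def eigenspace_eq dim_span_psi simp del: dim_span)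
  have "(\<Sum>j=1..r. \<mu> j) = (\<Sum>l\<in>\<Lambda>. \<Sum>j\<in>{j \<in> {1..r}. \<mu> j = l}. \<mu> j)"
    using \<mu>(1) assms(1) by (intro sum.group[symmetric]) auto
  also have "\<dots> = (\<Sum>l\<in>\<Lambda>. \<Sum>n\<in>{n \<in> {n. lam n \<in> \<Lambda>}. lam n = l}. lam n)"
  proof (rule sum.cong[OF refl])
    fix l assume l: "l \<in> \<Lambda>"
    have "(\<Sum>j\<in>{j \<in> {1..r}. \<mu> j = l}. \<mu> j) = of_nat (card {j \<in> {1..r}. \<mu> j = l}) * l" by simp
    also have "\<dots> = of_nat (card {n \<in> {n. lam n \<in> \<Lambda>}. lam n = l}) * l"
      using \<mu>(2)[OF l] l by (simp add: conj_commute cong: conj_cong)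
    also have "\<dots> = (\<Sum>n\<in>{n \<in> {n. lam n \<in> \<Lambda>}. lam n = l}. lam n)" by simp
    finally show "(\<Sum>j\<in>{j \<in> {1..r}. \<mu> j = l}. \<mu> j) = (\<Sum>n\<in>{n \<in> {n. lam n \<in> \<Lambda>}. lam n = l}. lam n)" .
  qed
  also have "\<dots> = (\<Sum>n\<in>{n. lam n \<in> \<Lambda>}. lam n)"
    using assms(1) by (intro sum.group finite_eigen_indices) auto
  finally show ?thesis .
qed

lemma subspace_error_le:
  assumes N: "finite N" and F: "F \<subseteq> H"
    and le: "\<And>v. v \<in> F - {0} \<Longrightarrow> B (v - expansion N v) (v - expansion N v) \<le> K * B v v"
  shows "subspace_error B (span (\<psi> ` N)) F \<le> ereal K"
  unfolding subspace_error_def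
proof (rule SUP_least)
  fix v assume v: "v \<in> F - {0}"
  then have vH: "v \<in> H" "B v v > 0" using F B_pos by auto
  have "v - expansion N v \<in> H" using vH(1) subspace_diff[OF subspace_H] expansion_in_H by blast
  then have "(energy_norm B (v - orth_proj (span (\<psi> ` N)) v))\<^sup>2 / (energy_norm B v)\<^sup>2
      = B (v - expansion N v) (v - expansion N v) / B v v"
    using vH B_nonneg by (simp add: energy_norm_def orth_proj_eq_expansion[OF N])
  also have "\<dots> \<le> K" using le[OF v] vH(2) by (simp add: pos_divide_le_eq)
  finally show "ereal ((energy_norm B (v - orth_proj (span (\<psi> ` N)) v))\<^sup>2 / (energy_norm B v)\<^sup>2) \<le> ereal K"
    by simp
qed

text \<open>
  The two properties of the constant that the residual estimate for one approximate eigenpair asks for.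
\<close>

lemma gap_const_max_bounds:
  assumes "finite \<Lambda>" "j \<in> {1..r}" "0 < \<mu>h j" "\<mu>h j \<notin> range lam - \<Lambda>"
  shows "1 \<le> gap_const_max (range lam) \<Lambda> r \<mu>h"
    and "lam n \<notin> \<Lambda> \<Longrightarrow> lam n \<le> gap_const_max (range lam) \<Lambda> r \<mu>h * \<bar>lam n - \<mu>h j\<bar>"
proof -
  let ?C = "gap_const_max (range lam) \<Lambda> r \<mu>h"
  have le: "gap_const (range lam) \<Lambda> (\<mu>h j) \<le> ?C"
    unfolding gap_const_max_def using assms(2) by (intro Max_ge) auto
  with gap_const_ge_1[OF assms(3,1)] show "1 \<le> ?C" by linarith
  assume n: "lam n \<notin> \<Lambda>"
  then have "lam n / \<bar>lam n - \<mu>h j\<bar> \<le> ?C"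
    using le_gap_const[OF assms(3), of "lam n" \<Lambda>] le by simp
  moreover have "0 < \<bar>lam n - \<mu>h j\<bar>" using n assms(4) by (metis DiffI rangeI zero_less_abs_iff right_minus_eq)
  ultimately show "lam n \<le> ?C * \<bar>lam n - \<mu>h j\<bar>" by (simp add: pos_divide_le_eq)
qed

text \<open>
  The Gram matrix represents the energy in the basis \<open>x\<close>; its positivity is the linear independence of the basis. The
  matrix is indexed from \<open>0\<close> and the basis from \<open>1\<close>, hence the successors.
\<close>

lemma min_eigenvalue_gram_mat:
  assumes r: "0 < r" and x: "\<And>j. j \<in> {1..r} \<Longrightarrow> x j \<in> H"
    and inj: "inj_on x {1..r}" and indep: "independent (x ` {1..r})"
  shows "0 < min_eigenvalue (gram_mat B r x)"
    and "min_eigenvalue (gram_mat B r x) * (\<Sum>j=1..r. (c j)\<^sup>2)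
      \<le> B (\<Sum>j=1..r. c j *\<^sub>R x j) (\<Sum>j=1..r. c j *\<^sub>R x j)"
proof -
  define g where "g = (\<lambda>i j. B (x (Suc j)) (x (Suc i)))"
  have x': "x (Suc i) \<in> H" if "i < r" for i using x that by simp
  have mat_form: "mat_form r g c c = B (\<Sum>i<r. c i *\<^sub>R x (Suc i)) (\<Sum>i<r. c i *\<^sub>R x (Suc i))" for c
  proof -
    have "B (\<Sum>i<r. c i *\<^sub>R x (Suc i)) (\<Sum>i<r. c i *\<^sub>R x (Suc i))
        = (\<Sum>i<r. c i * B (\<Sum>j<r. c j *\<^sub>R x (Suc j)) (x (Suc i)))"
      by (intro B_sum_right sum_in_H) (simp_all add: x')
    also have "\<dots> = (\<Sum>i<r. c i * (\<Sum>j<r. c j * B (x (Suc j)) (x (Suc i))))"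
      by (intro sum.cong refl arg_cong2[where f = "(*)"] B_sum_left) (simp_all add: x')
    also have "\<dots> = mat_form r g c c"
      by (simp add: mat_form_def g_def sum_distrib_left mult_ac)
    finally show ?thesis by simp
  qed
  have sym: "g i j = g j i" if "i < r" "j < r" for i j
    using x'[OF that(1)] x'[OF that(2)] B_sym by (simp add: g_def)
  have pos: "0 < mat_form r g c c" if "\<exists>i<r. c i \<noteq> 0" for c
  proof -
    have "(\<Sum>i<r. c i *\<^sub>R x (Suc i)) \<noteq> 0"
    proof
      assume 0: "(\<Sum>i<r. c i *\<^sub>R x (Suc i)) = 0"
      have inj': "inj_on (\<lambda>i. x (Suc i)) {..<r}"
        by (rule inj_onI) (use inj in \<open>auto dest: inj_onD\<close>)
      (* The coefficients as a function of the basis vectors, the shape that linear independence refers to. *)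
      define u where "u = (\<lambda>v. c (the_inv_into {..<r} (\<lambda>i. x (Suc i)) v))"
      have u: "u (x (Suc i)) = c i" if "i < r" for i
        using the_inv_into_f_f[OF inj', of i] that by (simp add: u_def)
      have "(\<Sum>v\<in>(\<lambda>i. x (Suc i)) ` {..<r}. u v *\<^sub>R v) = 0"
        using 0 by (simp add: sum.reindex[OF inj'] u)
      moreover have "(\<lambda>i. x (Suc i)) ` {..<r} \<subseteq> x ` {1..r}" by auto
      ultimately have "u (x (Suc i)) = 0" if "i < r" for i
        using that indep by (intro independentD[OF indep, of "(\<lambda>i. x (Suc i)) ` {..<r}"]) auto
      then show False using \<open>\<exists>i<r. c i \<noteq> 0\<close> u by auto
    qed
    then show ?thesis unfolding mat_form by (intro B_pos sum_in_H) (simp_all add: x')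
  qed
  have G: "gram_mat B r x = Matrix.mat r r (\<lambda>(i, j). g i j)"
    by (simp add: gram_mat_def g_def)
  show "0 < min_eigenvalue (gram_mat B r x)"
    unfolding G by (rule min_eigenvalue_rayleigh(1)[OF sym pos r])
  have "min_eigenvalue (gram_mat B r x) * (\<Sum>i<r. (c (Suc i))\<^sup>2) \<le> mat_form r g (\<lambda>i. c (Suc i)) (\<lambda>i. c (Suc i))"
    unfolding G by (rule min_eigenvalue_rayleigh(2)[OF sym pos r])
  then show "min_eigenvalue (gram_mat B r x) * (\<Sum>j=1..r. (c j)\<^sup>2)
      \<le> B (\<Sum>j=1..r. c j *\<^sub>R x j) (\<Sum>j=1..r. c j *\<^sub>R x j)"
    unfolding mat_form by (simp add: sum.atLeast1_atMost_eq)
qed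

lemma B_orthogonal_combination:
  assumes J: "finite J" and x: "\<And>j. j \<in> J \<Longrightarrow> x j \<in> H"
    and orth: "\<And>i j. i \<in> J \<Longrightarrow> j \<in> J \<Longrightarrow> B (x i) (x j) = (if i = j then w i else 0)"
  shows "B (\<Sum>j\<in>J. c j *\<^sub>R x j) (\<Sum>j\<in>J. c j *\<^sub>R x j) = (\<Sum>j\<in>J. w j * (c j)\<^sup>2)"
proof -
  have "B (x i) (\<Sum>j\<in>J. c j *\<^sub>R x j) = w i * c i" if "i \<in> J" for i
  proof -
    have "B (x i) (\<Sum>j\<in>J. c j *\<^sub>R x j) = (\<Sum>j\<in>J. c j * B (x i) (x j))"
      using x that by (intro B_sum_right) auto
    also have "\<dots> = (\<Sum>j\<in>J. if j = i then w i * c i else 0)"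
      using that by (intro sum.cong) (auto simp: orth)
    finally show ?thesis using J that by simp
  qed
  moreover have "B (\<Sum>j\<in>J. c j *\<^sub>R x j) (\<Sum>j\<in>J. c j *\<^sub>R x j) = (\<Sum>i\<in>J. c i * B (x i) (\<Sum>j\<in>J. c j *\<^sub>R x j))"
    by (intro B_sum_left sum_in_H x)
  ultimately show ?thesis by (simp add: power2_eq_square mult_ac)
qed

end

section \<open>The subspace and eigenvalue error estimates\<close>

lemma span_image_combination:
  fixes x :: "'i \<Rightarrow> 'v::real_vector"
  assumes "finite J" "inj_on x J" "v \<in> span (x ` J)"
  obtains c where "v = (\<Sum>j\<in>J. c j *\<^sub>R x j)"
proof -
  obtain u where "v = (\<Sum>y\<in>x ` J. u y *\<^sub>R y)"
    using assms(3) unfolding span_finite[OF finite_imageI[OF assms(1)]] by blast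
  then have "v = (\<Sum>j\<in>J. u (x j) *\<^sub>R x j)" by (simp add: sum.reindex[OF assms(2)])
  then show ?thesis by (rule that)
qed

theorem theorem2p2:
  fixes \<Omega> \<Gamma> :: "(real^'d::finite) set"
    and A :: "real^'d \<Rightarrow> real^'d^'d" and b :: "real^'d \<Rightarrow> real"
    and L H E Eh :: "(real^'d) L2 set"
    and B :: "(real^'d) L2 \<Rightarrow> (real^'d) L2 \<Rightarrow> real"
    and lam \<mu>h :: "nat \<Rightarrow> real" and \<psi> \<phi> :: "nat \<Rightarrow> (real^'d) L2"
    and \<sigma> \<Lambda> :: "real set" and r :: nat and C :: real
  assumes "open \<Omega>" and "bounded \<Omega>" and "\<Gamma> \<subseteq> frontier \<Omega>"
    and "\<And>i j. Linf_on \<Omega> (\<lambda>x. A x $ i $ j)" and "Linf_on \<Omega> b"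
    and "L = L2_on \<Omega>" and "H = H1_bc \<Omega> \<Gamma>" and "B = bform \<Omega> A b"
    and "inner_product_on H B"
    and "norms_equivalent_on H (energy_norm B) (norm_H1 \<Omega>)"
    and "\<sigma> = op_spec L H B"
    and "spectral_setting L H B lam \<psi>"
    and "\<Lambda> \<subseteq> \<sigma>" and "finite \<Lambda>"
    and "E = inv_subspace L H B \<Lambda>" and "r = dim E"
    and "subspace Eh" and "Eh \<subseteq> H" and "dim Eh = r"
    and "inj_on \<phi> {1..r}" and "independent (\<phi> ` {1..r})" and "span (\<phi> ` {1..r}) = Eh"
    and "\<And>i. i \<in> {1..r} \<Longrightarrow> 0 < \<mu>h i" and "mono_on {1..r} \<mu>h"
    and "\<And>i. i \<in> {1..r} \<Longrightarrow> \<mu>h i \<notin> \<sigma> - \<Lambda>"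
    and "C = gap_const_max \<sigma> \<Lambda> r \<mu>h"
  shows "subspace_error B E Eh
           \<le> ereal (C\<^sup>2 / min_eigenvalue (gram_mat B r \<phi>) * (\<Sum>j=1..r. (residual H B (\<mu>h j) (\<phi> j))\<^sup>2))
    \<and> ((\<forall>i\<in>{1..r}. \<forall>j\<in>{1..r}. B (\<phi> i) (\<phi> j) = (if i = j then \<mu>h i else 0)) \<longrightarrow>
        subspace_error B E Eh
          \<le> ereal (C\<^sup>2 * (\<Sum>j=1..r. (residual H B (\<mu>h j) (\<phi> j))\<^sup>2 / \<mu>h j))
        \<and> ((\<forall>i\<in>{1..r}. \<forall>j\<in>{1..r}. inner (\<phi> i) (\<phi> j) = (if i = j then 1 else 0)) \<longrightarrow>
            (\<forall>\<mu>. lists_eigenvalues L H B \<Lambda> r \<mu> \<longrightarrow>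
              (\<Sum>j=1..r. \<mu>h j - \<mu> j) \<le> C\<^sup>2 * (\<Sum>j=1..r. (residual H B (\<mu>h j) (\<phi> j))\<^sup>2))))"
proof -
  have "H \<subseteq> L"
    using assms(6,7) by (auto simp: H1_bc_def H1_def)
  then interpret form_with_eigenbasis L H B lam \<psi>
    using assms(1,7,9,12) subspace_H1_bc by unfold_locales auto
  define N where "N = {n. lam n \<in> \<Lambda>}"
  have N: "finite N" unfolding N_def using finite_eigen_indices assms(14) by blast
  have E: "E = span (\<psi> ` N)" unfolding assms(15) N_def by (rule inv_subspace_eq)
  have \<sigma>: "\<sigma> = range lam" using assms(11) spec_eq by simp
  let ?R = "\<lambda>j. (residual H B (\<mu>h j) (\<phi> j))\<^sup>2"
  have \<phi>H: "\<phi> j \<in> H" if "j \<in> {1..r}" for j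
    using that assms(18,22) span_base[of "\<phi> j" "\<phi> ` {1..r}"] by blast
  have key: "B (\<phi> j - expansion N (\<phi> j)) (\<phi> j - expansion N (\<phi> j)) \<le> C\<^sup>2 * ?R j" if j: "j \<in> {1..r}" for j
  proof -
    have "\<mu>h j \<notin> range lam - \<Lambda>" using assms(25)[OF j] \<sigma> by simp
    note C = gap_const_max_bounds[where \<mu>h = \<mu>h and j = j, OF assms(14) j assms(23)[OF j] this, folded \<sigma>, folded assms(26)]
    show ?thesis
      using energy_complement_le_residual[OF \<phi>H[OF j] N C(1), of "\<mu>h j"] C(2)
      by (simp add: N_def power_mult_distrib)
  qed
  have error: "subspace_error B E Eh \<le> ereal (\<Sum>j=1..r. C\<^sup>2 * ?R j / w j)"
    if w: "\<And>j. j \<in> {1..r} \<Longrightarrow> 0 < w j"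
      and coercive: "\<And>c. 0 < r \<Longrightarrow> (\<Sum>j=1..r. w j * (c j)\<^sup>2)
        \<le> B (\<Sum>j=1..r. c j *\<^sub>R \<phi> j) (\<Sum>j=1..r. c j *\<^sub>R \<phi> j)" for w
    unfolding E
  proof (rule subspace_error_le[OF N assms(18)])
    fix v assume v: "v \<in> Eh - {0}"
    then obtain c where c: "v = (\<Sum>j=1..r. c j *\<^sub>R \<phi> j)"
      using span_image_combination[OF _ assms(20), of v] assms(22) by auto
    (* A nonzero vector exists only if the basis is nonempty; this excludes the Gram matrix of size 0. *)
    have "0 < r" using v c by (cases r) auto
    from coercive[OF this, of c] show "B (v - expansion N v) (v - expansion N v)
        \<le> (\<Sum>j=1..r. C\<^sup>2 * ?R j / w j) * B v v"
      unfolding c[symmetric]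
      by (intro complement_of_combination_le[OF N \<phi>H w c _ key])
  qed
  have "subspace_error B E Eh \<le> ereal (\<Sum>j=1..r. C\<^sup>2 * ?R j / min_eigenvalue (gram_mat B r \<phi>))"
  proof (rule error)
    show "0 < min_eigenvalue (gram_mat B r \<phi>)" if "j \<in> {1..r}" for j
      using that by (intro min_eigenvalue_gram_mat \<phi>H assms) auto
    show "(\<Sum>j=1..r. min_eigenvalue (gram_mat B r \<phi>) * (c j)\<^sup>2)
        \<le> B (\<Sum>j=1..r. c j *\<^sub>R \<phi> j) (\<Sum>j=1..r. c j *\<^sub>R \<phi> j)" if "0 < r" for c
      unfolding sum_distrib_left[symmetric] using that by (intro min_eigenvalue_gram_mat \<phi>H assms)
  qed
  also have "(\<Sum>j=1..r. C\<^sup>2 * ?R j / min_eigenvalue (gram_mat B r \<phi>))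
      = C\<^sup>2 / min_eigenvalue (gram_mat B r \<phi>) * (\<Sum>j=1..r. ?R j)"
    by (simp add: sum_distrib_left)
  finally have first: "subspace_error B E Eh
      \<le> ereal (C\<^sup>2 / min_eigenvalue (gram_mat B r \<phi>) * (\<Sum>j=1..r. ?R j))" .
  have second: "subspace_error B E Eh \<le> ereal (C\<^sup>2 * (\<Sum>j=1..r. ?R j / \<mu>h j))"
    if orth: "\<forall>i\<in>{1..r}. \<forall>j\<in>{1..r}. B (\<phi> i) (\<phi> j) = (if i = j then \<mu>h i else 0)"
  proof -
    have "subspace_error B E Eh \<le> ereal (\<Sum>j=1..r. C\<^sup>2 * ?R j / \<mu>h j)"
      using orth by (intro error assms(23) eq_refl B_orthogonal_combination[symmetric] \<phi>H) auto
    then show ?thesis by (simp add: sum_distrib_left)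
  qed
  have third: "(\<Sum>j=1..r. \<mu>h j - \<mu> j) \<le> C\<^sup>2 * (\<Sum>j=1..r. ?R j)"
    if orth: "\<forall>i\<in>{1..r}. \<forall>j\<in>{1..r}. B (\<phi> i) (\<phi> j) = (if i = j then \<mu>h i else 0)"
      and orthonormal: "\<forall>i\<in>{1..r}. \<forall>j\<in>{1..r}. inner (\<phi> i) (\<phi> j) = (if i = j then 1 else 0)"
      and listed: "lists_eigenvalues L H B \<Lambda> r \<mu>" for \<mu>
  proof -
    have "(\<Sum>j=1..r. \<mu>h j - \<mu> j) = (\<Sum>j=1..r. B (\<phi> j) (\<phi> j)) - (\<Sum>n\<in>N. lam n)"
      using orth sum_listed_eigenvalues[OF assms(14) listed] by (simp add: sum_subtractf N_def)
    also have "\<dots> \<le> (\<Sum>j=1..r. B (\<phi> j - expansion N (\<phi> j)) (\<phi> j - expansion N (\<phi> j)))"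
      by (rule eigenvalue_sum_le[OF N _ \<phi>H]) (use orthonormal in auto)
    also have "\<dots> \<le> (\<Sum>j=1..r. C\<^sup>2 * ?R j)" by (rule sum_mono) (rule key)
    finally show ?thesis by (simp add: sum_distrib_left)
  qed
  from first second third show ?thesis by blast
qed

end
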